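(* Let $W$ be the Coxeter group of type $A_3$, let $c=(s_2,s_1,s_3)$ and $Q=c^m$ with $m\ge3$. Let $\mathbf a=\{a_i,b_i,c_i\}_{i=1,\dots,m}$ be any choice of real parameters satisfying the $c$-signature inequalities $$a_i-a_{i-1}>0,\qquad b_i-b_{i-1}>0,\qquad c_i-c_{i-1}>0\qquad(2\le i\le m),$$ $$2a_i-b_i-c_i+2a_j-b_j-c_j+2>0\qquad(1\le i,j\le m,\ i\ne j),$$ $$b_i+c_i-2a_{i-1}+b_j+c_j-2a_{j-1}-2>0\qquad(2\le i,j\le m,\ i\ne j).$$ Let $D_{213,\mathbf a}=\big(\widehat D^{\mathbf a}_m\,|\,\cdots\,|\,\widehat D^{\mathbf a}_1\big)$ be the $6\times 3m$ matrix with blocks $$\widehat D_i^{\mathbf a}=\begin{pmatrix}1&0&0\\ a_i&m-b_i+1&0\\ a_i&0&m-c_i+1\\ a_i^2&\binom{m+1}{2}-\binom{b_i}{2}&\binom{m+1}{2}-\binom{c_i}{2}\\ 0&0&1\\ 0&1&0\end{pmatrix},$$ and let $M_{213,\mathbf a}$ be any Gale dual matrix of $D_{213,\mathbf a}$. Then the fan $\mathcal F_{Q,M_{213,\mathbf a}}$ is a complete fan realizing the subword complex $\mathcal{SC}(Q)$. In particular, it is a complete fan realizing the multi-associahedron $\Delta_{2k+4,k}$ for $k=m-2$.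
   Context: Type $A_3$: $W$ is the symmetric group on 4 letters with $s_i=(i\ \ i+1)$; $w_\circ$ is its longest element, of length $N=6$. $c^m$ is the concatenation of $m$ copies of the word $c$, with $r=3m$ letters. For real $x$, $\binom{x}{2}=x(x-1)/2$. Subword complex: $\mathcal{SC}(Q)$, for a word $Q=(q_1,\dots,q_r)$, is the simplicial complex whose faces are the subsets $I\subset[r]$ such that the subword of $Q$ with positions in $[r]\smallsetminus I$ contains a reduced expression of $w_\circ$ as a subword. Gale dual: for a full rank matrix $A$, $B$ is a Gale dual matrix of $A$ if the rows of $B$ form a basis of $\ker A$. Fan: for $M\in\mathbb R^{(r-N)\times r}$ with columns $M_1,\dots,M_r$, $\mathcal F_{Q,M}$ is the collection of cones $\operatorname{cone}(M_i:i\in I)\subset\mathbb R^{r-N}$ for $I$ a face of $\mathcal{SC}(Q)$. It is a complete (simplicial) fan realizing $\mathcal{SC}(Q)$ if for every face $I$ the vectors $(M_i)_{i\in I}$ are linearly independent, the cones of any two faces $I,J$ intersect exactly in the cone of $I\cap J$, and the union of all cones is $\mathbb R^{r-N}$. A complete simplicial fan realizes a simplicial complex $\Delta$ if its poset of cones is isomorphic to the face poset of $\Delta$. Multi-associahedron: a set of $k+1$ pairwise crossing diagonals of a convex $\ell$-gon is a $(k+1)$-crossing; a diagonal is $k$-relevant if it has at least $k$ vertices of the $\ell$-gon on each side. $\Delta_{\ell,k}$ is the simplicial complex of $(k+1)$-crossing-free sets of $k$-relevant diagonals of a convex $\ell$-gon. When $\ell=2k+4$ and $m=k+2$, label the vertices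 cyclically $1,\dots,\ell$; the correspondence between diagonals and positions of $Q$ sends the first $k$-relevant diagonal in lexicographic order to the last position of $Q$ and the remaining ones, in lexicographic order, to positions $1,\dots,3k+5$. *)

theory Defs
  imports
    "HOL-Analysis.Analysis"
    "HOL-Combinatorics.Permutations"
    "HOL-Library.Sublist"
begin

section \<open>The Coxeter group of type A3 and subword complexes\<close>

text \<open>The group is the set of permutations of \<open>{1..4}\<close>; a word is a list of indices
  \<open>i \<in> {1,2,3}\<close>, where \<open>i\<close> stands for the generator \<open>s\<^sub>i = (i i+1)\<close>.\<close>

definition A3_gen :: "nat \<Rightarrow> nat \<Rightarrow> nat" where
  "A3_gen i = Transposition.transpose i (i + 1)"

definition word_prod :: "nat list \<Rightarrow> nat \<Rightarrow> nat" where
  "word_prod ws = foldr (\<lambda>i w. A3_gen i \<circ> w) ws id"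

definition expresses :: "nat list \<Rightarrow> (nat \<Rightarrow> nat) \<Rightarrow> bool" where
  "expresses ws w \<longleftrightarrow> set ws \<subseteq> {1, 2, 3} \<and> word_prod ws = w"

definition coxeter_length :: "(nat \<Rightarrow> nat) \<Rightarrow> nat" where
  "coxeter_length w = (LEAST n. \<exists>ws. expresses ws w \<and> length ws = n)"

definition reduced_expression :: "nat list \<Rightarrow> (nat \<Rightarrow> nat) \<Rightarrow> bool" where
  "reduced_expression ws w \<longleftrightarrow> expresses ws w \<and> length ws = coxeter_length w"

definition longest_element :: "nat \<Rightarrow> nat" where
  "longest_element = (ARG_MAX coxeter_length w. w permutes {1..4})"

text \<open>Positions of a word are numbered from 1, whereas \<^const>\<open>nths\<close> counts from 0.\<close>

definition subword_complex :: "nat list \<Rightarrow> nat set set" where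
  "subword_complex Q = {I. I \<subseteq> {1..length Q} \<and>
     (\<exists>ws. subseq ws (nths Q {p. Suc p \<notin> I}) \<and> reduced_expression ws longest_element)}"

definition c213_power :: "nat \<Rightarrow> nat list" where
  "c213_power m = concat (replicate m [2, 1, 3])"


section \<open>Fans\<close>

text \<open>Since \<open>convex_cone hull {} = {0}\<close>, the empty face spans the cone \<open>{0}\<close>.\<close>

definition cone_of :: "('i \<Rightarrow> 'v::real_vector) \<Rightarrow> 'i set \<Rightarrow> 'v set" where
  "cone_of V I = convex_cone hull (V ` I)"

definition fan_cones :: "'i set set \<Rightarrow> ('i \<Rightarrow> 'v::real_vector) \<Rightarrow> 'v set set" where
  "fan_cones \<Delta> V = cone_of V ` \<Delta>"

definition complete_fan_realizing :: "'i set set \<Rightarrow> ('i \<Rightarrow> 'v::real_vector) \<Rightarrow> bool" where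
  "complete_fan_realizing \<Delta> V \<longleftrightarrow>
     (\<forall>I\<in>\<Delta>. inj_on V I \<and> independent (V ` I)) \<and>
     (\<forall>I\<in>\<Delta>. \<forall>J\<in>\<Delta>. cone_of V I \<inter> cone_of V J = cone_of V (I \<inter> J)) \<and>
     \<Union>(fan_cones \<Delta> V) = UNIV"

text \<open>Isomorphism of two families of sets, each ordered by inclusion; used for the poset of
  cones of a fan and the face poset of a simplicial complex.\<close>

definition poset_isomorphic :: "'a set set \<Rightarrow> 'b set set \<Rightarrow> bool" where
  "poset_isomorphic \<F> \<Delta> \<longleftrightarrow>
     (\<exists>\<phi>. bij_betw \<phi> \<F> \<Delta> \<and> (\<forall>C\<in>\<F>. \<forall>D\<in>\<F>. C \<subseteq> D \<longleftrightarrow> \<phi> C \<subseteq> \<phi> D))"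


section \<open>Multi-associahedra\<close>

text \<open>The diagonals of the convex polygon with vertices \<open>1, \<dots>, l\<close> (in cyclic order) are
  represented by pairs \<open>(i, j)\<close> with \<open>i < j\<close>.\<close>

definition diagonals :: "nat \<Rightarrow> (nat \<times> nat) set" where
  "diagonals l = {(i, j). 1 \<le> i \<and> i + 2 \<le> j \<and> j \<le> l \<and> (i, j) \<noteq> (1, l)}"

definition crossing :: "nat \<times> nat \<Rightarrow> nat \<times> nat \<Rightarrow> bool" where
  "crossing d e \<longleftrightarrow>
     fst d < fst e \<and> fst e < snd d \<and> snd d < snd e \<or>
     fst e < fst d \<and> fst d < snd e \<and> snd e < snd d"

definition relevant_diagonals :: "nat \<Rightarrow> nat \<Rightarrow> (nat \<times> nat) set" where
  "relevant_diagonals l k = {(i, j) \<in> diagonals l.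
     k \<le> card {v \<in> {1..l}. i < v \<and> v < j} \<and> k \<le> card {v \<in> {1..l}. v < i \<or> j < v}}"

definition multi_associahedron :: "nat \<Rightarrow> nat \<Rightarrow> (nat \<times> nat) set set" where
  "multi_associahedron l k = {S. S \<subseteq> relevant_diagonals l k \<and>
     \<not> (\<exists>T \<subseteq> S. card T = k + 1 \<and> pairwise crossing T)}"


section \<open>Gale duality\<close>

definition full_rank :: "real^'r^'p \<Rightarrow> bool" where
  "full_rank A \<longleftrightarrow> rank A = min CARD('p) CARD('r)"

definition gale_dual :: "real^'r^'p \<Rightarrow> real^'r^'d \<Rightarrow> bool" where
  "gale_dual A B \<longleftrightarrow> full_rank A \<and>
     inj (\<lambda>i. row i B) \<and> independent (rows B) \<and> span (rows B) = {x. A *v x = 0}"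

text \<open>The columns of a matrix are indexed by a finite linearly ordered type \<open>'r\<close>; the
  order identifies \<open>'r\<close> with \<open>{1..CARD('r)}\<close>.\<close>

definition position :: "'r::{finite,linorder} \<Rightarrow> nat" where
  "position j = card {..j}"

lemma bij_betw_position:
  "bij_betw (position :: 'r::{finite,linorder} \<Rightarrow> nat) UNIV {1..CARD('r)}"
proof -
  have "strict_mono (position :: 'r \<Rightarrow> nat)"
    unfolding position_def by (intro strict_monoI psubset_card_mono) auto
  hence inj: "inj (position :: 'r \<Rightarrow> nat)"
    by (rule strict_mono_imp_inj_on)
  have "range (position :: 'r \<Rightarrow> nat) \<subseteq> {1..CARD('r)}"
    by (auto simp: position_def Suc_le_eq card_gt_0_iff intro!: card_mono)
  moreover have "card (range (position :: 'r \<Rightarrow> nat)) = card {1..CARD('r)}"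
    using inj by (simp add: card_image)
  ultimately have "range (position :: 'r \<Rightarrow> nat) = {1..CARD('r)}"
    by (intro card_subset_eq) auto
  with inj show ?thesis
    by (simp add: bij_betw_def)
qed

definition column_at :: "real^'r::{finite,linorder}^'d \<Rightarrow> nat \<Rightarrow> real^'d" where
  "column_at M p = column (inv position p) M"


section \<open>Signature inequalities and the matrix D213\<close>

definition c213_signature_inequalities ::
  "nat \<Rightarrow> (nat \<Rightarrow> real) \<Rightarrow> (nat \<Rightarrow> real) \<Rightarrow> (nat \<Rightarrow> real) \<Rightarrow> bool" where
  "c213_signature_inequalities m a b c \<longleftrightarrow>
     (\<forall>i\<in>{2..m}. a i - a (i - 1) > 0 \<and> b i - b (i - 1) > 0 \<and> c i - c (i - 1) > 0) \<and>
     (\<forall>i\<in>{1..m}. \<forall>j\<in>{1..m}. i \<noteq> j \<longrightarrow>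
        2 * a i - b i - c i + 2 * a j - b j - c j + 2 > 0) \<and>
     (\<forall>i\<in>{2..m}. \<forall>j\<in>{2..m}. i \<noteq> j \<longrightarrow>
        b i + c i - 2 * a (i - 1) + b j + c j - 2 * a (j - 1) - 2 > 0)"

definition D213_block :: "real \<Rightarrow> real \<Rightarrow> real \<Rightarrow> real \<Rightarrow> real^3^6" where
  "D213_block m a b c = vector
     [vector [1,   0,                                   0],
      vector [a,   m - b + 1,                           0],
      vector [a,   0,                                   m - c + 1],
      vector [a^2, ((m + 1) gchoose 2) - (b gchoose 2), ((m + 1) gchoose 2) - (c gchoose 2)],
      vector [0,   0,                                   1],
      vector [0,   1,                                   0]]"

text \<open>The blocks are arranged from left to right with decreasing index \<open>m, \<dots>, 1\<close>.\<close>

definition D213 ::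
  "nat \<Rightarrow> (nat \<Rightarrow> real) \<Rightarrow> (nat \<Rightarrow> real) \<Rightarrow> (nat \<Rightarrow> real) \<Rightarrow> real^'r::{finite,linorder}^6" where
  "D213 m a b c = (\<chi> t j.
     let q = position j - 1; i = m - q div 3
     in D213_block (real m) (a i) (b i) (c i) $ t $ of_nat (q mod 3 + 1))"

end

(* Gale duality turns the statement into one about functions on the positions of Q: let g p be the
   value of a fixed linear functional on the p-th column of D.  Some point of the ambient space has
   two different nonnegative representations supported on faces iff some nonzero g is >= 0 on one
   reduced word of the longest element and <= 0 on another one.  On the letters 1, 2, 3 the function
   g is given by quadratic polynomials evaluated at b_i, a_i + 1/2, c_i; their leading coefficients
   are in the ratio -1/2 : 1 : -1/2 and their linear coefficients sum to 0.  A word contains a reduced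
   word of the longest element iff it contains 123, 321 and one of 2132, 2312 as subwords.  Combined
   with the sign patterns of such quadratics, the signature inequalities force g = 0.

   Uniqueness of representations also places the two facets at a ridge on opposite sides of it.  A
   segment that avoids all faces of codimension at least 2 can therefore never leave the union of the
   cones, so the fan is complete.

   An (m-1)-crossing of the (2m)-gon contains, for all but one i in 1..m, exactly one of three diagonals
   indexed by i; the crossing conditions between consecutive indices leave exactly the sets of
   positions whose complement misses one of the three subwords. *)
theory Submission
  imports Defs
begin

section \<open>Reduced words of the longest element\<close>

text \<open>If two nonnegative coefficient vectors supported on faces have the same image under M,
  their difference lies in the kernel of M, which is the row space of D. It is >= 0 outside the
  support of the second and <= 0 outside the support of the first, and both complements contain a
  reduced word: hence the two sign patterns. The six rows of D amount to one leading coefficient,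
  three slopes with one relation, and three constants. For a nonzero leading coefficient the
  relation says that the vertices p of the parabola at letter 2 and q, r of those at 1 and 3 satisfy
  2p = q + r. The signature inequalities see the parameters only through differences and through b +
  c - 2A, possibly with shifted indices, so they survive moving all three vertices to 0. Signs then
  become comparisons of absolute values with thresholds. The inequalities constrain pairs of
  indices, and a single index may violate its half. So every contradiction has to produce two
  different indices, and the thresholds cancel in the sum over the two.\<close>

definition w0_words :: "nat list list" where
  "w0_words =
    [[1,2,3,1,2,1], [1,2,1,3,2,1], [2,1,2,3,2,1], [2,3,1,2,3,1], [2,1,3,2,3,1], [1,2,3,2,1,2],
     [3,1,2,3,1,2], [1,3,2,3,1,2], [3,1,2,1,3,2], [1,3,2,1,3,2], [3,2,1,2,3,2], [2,3,1,2,1,3],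
     [2,1,3,2,1,3], [2,3,2,1,2,3], [3,2,3,1,2,3], [3,2,1,3,2,3]]"

text \<open>Prepending a letter multiplies on the left, which acts on the values of the one-line
  notation and leaves its places alone.\<close>

definition swap_values :: "nat \<Rightarrow> nat list \<Rightarrow> nat list" where
  "swap_values i = map (\<lambda>x. if x = i then Suc i else if x = Suc i then i else x)"

definition one_line :: "nat list \<Rightarrow> nat list" where
  "one_line ws = foldr swap_values ws [1, 2, 3, 4]"

lemma one_line_eq: "one_line ws = map (word_prod ws) [1, 2, 3, 4]"
proof (induction ws)
  case (Cons i ws)
  have "one_line (i # ws) = swap_values i (one_line ws)"
    by (simp add: one_line_def)
  with Cons show ?case
    by (simp add: swap_values_def word_prod_def A3_gen_def Transposition.transpose_def)
qed (simp add: one_line_def word_prod_def)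

lemma word_prod_outside:
  assumes "set ws \<subseteq> {1, 2, 3}" "x \<notin> {1..4}"
  shows "word_prod ws x = x"
  using assms(1)
proof (induction ws)
  case (Cons i ws)
  then show ?case using assms(2)
    by (auto simp: word_prod_def A3_gen_def Transposition.transpose_def)
qed (simp add: word_prod_def)

text \<open>Each word carries its one-line notation along, so that under evaluation a longer word
  costs a single \<open>swap_values\<close>.\<close>

fun one_line_words :: "nat \<Rightarrow> (nat list \<times> nat list) list" where
  "one_line_words 0 = [([], [1, 2, 3, 4])]"
| "one_line_words (Suc n) =
     concat (map (\<lambda>(ws, p). map (\<lambda>i. (i # ws, swap_values i p)) [1, 2, 3]) (one_line_words n))"

lemma set_one_line_words:
  "set (one_line_words n) = (\<lambda>ws. (ws, one_line ws)) ` {ws. length ws = n \<and> set ws \<subseteq> {1, 2, 3}}"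
proof (induction n)
  case (Suc n)
  have *: "{ws. length ws = Suc n \<and> set ws \<subseteq> {1, 2, 3::nat}} =
      (\<Union>ws\<in>{ws. length ws = n \<and> set ws \<subseteq> {1, 2, 3}}. \<Union>i\<in>{1, 2, 3}. {i # ws})"
    by (auto simp: length_Suc_conv)
  show ?case
    unfolding * by (simp add: Suc image_UN UN_UN_flatten one_line_def) auto
qed (auto simp: one_line_def)

text \<open>Evaluation over all 3^6 words finds exactly 16 reduced words. The equality is one of
  lists, so \<open>w0_words\<close> follows the order of the enumeration.\<close>

lemma w0_words_length_6:
  "map fst (filter (\<lambda>(ws, p). p = [4, 3, 2, 1]) (one_line_words 6)) = w0_words"
  by code_simp

lemma one_line_words_length_less_6:
  "list_all (\<lambda>n. list_all (\<lambda>(ws, p). p \<noteq> [4, 3, 2, 1]) (one_line_words n)) [0..<6]"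
  by code_simp

text \<open>One word for each of the 23 permutations other than the longest element, in the order of
  \<open>shorter_one_lines\<close>; their lengths bound \<open>coxeter_length\<close> from
  above.\<close>

definition shorter_words :: "nat list list" where
  "shorter_words =
    [[], [1], [2], [3], [1,2], [2,1], [2,3], [3,2],
     [3,1], [1,2,1], [2,3,2], [1,2,3], [3,2,1], [3,1,2], [2,3,1], [1,2,3,1],
     [2,3,1,2], [1,2,3,2], [2,3,2,1], [3,1,2,1], [1,2,3,1,2], [2,3,1,2,1], [1,2,3,2,1]]"

definition shorter_one_lines :: "nat list list" where
  "shorter_one_lines =
    [[1,2,3,4], [2,1,3,4], [1,3,2,4], [1,2,4,3], [2,3,1,4], [3,1,2,4], [1,3,4,2], [1,4,2,3],
     [2,1,4,3], [3,2,1,4], [1,4,3,2], [2,3,4,1], [4,1,2,3], [2,4,1,3], [3,1,4,2], [3,2,4,1],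
     [3,4,1,2], [2,4,3,1], [4,1,3,2], [4,2,1,3], [3,4,2,1], [4,3,1,2], [4,2,3,1]]"

lemma one_line_shorter_words: "map one_line shorter_words = shorter_one_lines"
  by code_simp

lemma permutation_lists_4:
  "list_all (\<lambda>x. list_all (\<lambda>y. list_all (\<lambda>z. list_all (\<lambda>u.
     distinct [x, y, z, u] \<longrightarrow> [x, y, z, u] \<in> set ([4, 3, 2, 1] # shorter_one_lines))
     [1..<5]) [1..<5]) [1..<5]) [1..<5]"
  by code_simp

section \<open>Identification of the longest element\<close>

definition reversal :: "nat \<Rightarrow> nat" where
  "reversal x = (if x \<in> {1..4} then 5 - x else x)"

lemma word_prod_eq_iff:
  assumes "set ws \<subseteq> {1, 2, 3}" "\<And>x. x \<notin> {1..4} \<Longrightarrow> w x = x"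
  shows "word_prod ws = w \<longleftrightarrow> one_line ws = map w [1, 2, 3, 4]"
proof
  assume *: "one_line ws = map w [1, 2, 3, 4]"
  show "word_prod ws = w"
  proof
    fix x
    have "x \<in> {1, 2, 3, 4}" if "x \<in> {1..4}" for x :: nat using that by auto
    with * show "word_prod ws x = w x"
      using word_prod_outside[OF assms(1), of x] assms(2)[of x]
      by (cases "x \<in> {1..4}") (fastforce simp: one_line_eq simp del: atLeastAtMost_iff)+
  qed
qed (simp add: one_line_eq)

lemma expresses_reversal_iff:
  "expresses ws reversal \<longleftrightarrow> set ws \<subseteq> {1, 2, 3} \<and> one_line ws = [4, 3, 2, 1]"
proof -
  have "map reversal [1, 2, 3, 4] = [4, 3, 2, 1]"
    by (simp add: reversal_def)
  moreover have "reversal x = x" if "x \<notin> {1..4}" for x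
    using that by (simp only: reversal_def if_False)
  ultimately show ?thesis
    unfolding expresses_def using word_prod_eq_iff[of ws reversal] by metis
qed

lemma expresses_reversal_length: 
  assumes "expresses ws reversal" shows "6 \<le> length ws"
proof (rule ccontr)
  assume "\<not> 6 \<le> length ws"
  then have "(ws, one_line ws) \<in> set (one_line_words (length ws))" "length ws \<in> set [0..<6]"
    using assms by (auto simp: set_one_line_words expresses_reversal_iff)
  then show False
    using one_line_words_length_less_6 assms
    by (force simp: list_all_iff expresses_reversal_iff)
qed

lemma expresses_reversal_length_6:
  "expresses ws reversal \<and> length ws = 6 \<longleftrightarrow> ws \<in> set w0_words"
  unfolding w0_words_length_6[symmetric] expresses_reversal_iff
  by (force simp: set_one_line_words)

lemma coxeter_length_reversal: "coxeter_length reversal = 6"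
  unfolding coxeter_length_def
proof (rule Least_equality)
  have "[1,2,1,3,2,1] \<in> set w0_words" by (simp add: w0_words_def)
  then show "\<exists>ws. expresses ws reversal \<and> length ws = 6"
    using expresses_reversal_length_6 by blast
qed (use expresses_reversal_length in auto)

text \<open>The strict inequality makes the maximiser unique; without uniqueness
  \<open>ARG_MAX\<close> would be an unspecified choice among several elements.\<close>

lemma coxeter_length_less_6:
  assumes w: "w permutes {1..4}" and "w \<noteq> reversal"
  shows "coxeter_length w < 6"
proof -
  have w_in: "w x \<in> set [1..<5]" if "x \<in> {1..4}" for x
    using permutes_in_image[OF w, of x] that by auto
  have out: "w x = x" if "x \<notin> {1..4}" for x
    using w that by (simp add: permutes_not_in)
  have "map w [1, 2, 3, 4] \<noteq> [4, 3, 2, 1]"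
  proof
    assume *: "map w [1, 2, 3, 4] = [4, 3, 2, 1]"
    have "w x = reversal x" for x
    proof (cases "x \<in> {1..4}")
      case True
        then have "x \<in> {1, 2, 3, 4}" by auto
      with * show ?thesis by (auto simp: reversal_def)
    next
      case False
      then show ?thesis by (simp add: out reversal_def del: atLeastAtMost_iff)
    qed
    with \<open>w \<noteq> reversal\<close> show False by auto
  qed
  moreover have "distinct [w 1, w 2, w 3, w 4]"
    using permutes_inj[OF w] by (simp add: inj_eq)
  moreover have "w 1 \<in> set [1..<5]" "w 2 \<in> set [1..<5]" "w 3 \<in> set [1..<5]" "w 4 \<in> set [1..<5]"
    by (rule w_in, simp)+
  ultimately have "[w 1, w 2, w 3, w 4] \<in> set shorter_one_lines"
    using permutation_lists_4 unfolding list_all_iff by fastforce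
  then obtain ws where ws: "one_line ws = [w 1, w 2, w 3, w 4]" "ws \<in> set shorter_words"
    unfolding one_line_shorter_words[symmetric] set_map by (metis imageE)
  have short: "set ws \<subseteq> {1, 2, 3}" "length ws < 6"
    using ws(2) unfolding shorter_words_def by auto
  then have "expresses ws w"
    using word_prod_eq_iff[OF short(1), of w] out ws(1) short(1) by (simp add: expresses_def)
  then have "coxeter_length w \<le> length ws"
    unfolding coxeter_length_def by (intro Least_le) blast
  with short(2) show ?thesis by simp
qed

lemma longest_element_eq: "longest_element = reversal"
proof -
  have "reversal permutes {1..4}"
    unfolding permutes_def reversal_def
  proof (intro conjI allI impI)
    fix y :: nat
    show "\<exists>!x. (if x \<in> {1..4} then 5 - x else x) = y"
    proof (cases "y \<in> {1..4}")
      case True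
      then show ?thesis by (intro ex1I[of _ "5 - y"]) (auto split: if_splits)
    next
      case False
      then show ?thesis by (intro ex1I[of _ y]) (auto split: if_splits)
    qed
  qed auto
  then have "is_arg_max coxeter_length (\<lambda>w. w permutes {1..4}) w \<longleftrightarrow> w = reversal" for w
    using coxeter_length_less_6 coxeter_length_reversal
    unfolding is_arg_max_def by (metis less_irrefl not_less_iff_gr_or_eq)
  then show ?thesis
    by (simp add: longest_element_def arg_max_def)
qed

lemma reduced_expression_longest_element_iff:
  "reduced_expression ws longest_element \<longleftrightarrow> ws \<in> set w0_words"
  using expresses_reversal_length_6[of ws]
  by (simp add: reduced_expression_def longest_element_eq coxeter_length_reversal)

text \<open>The exchange property for the longest element: after inserting a letter \<open>x\<close>
  at place \<open>k\<close> of a reduced word, some other letter can be deleted to leave a reduced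
  word again. This yields the flips between facets.\<close>

lemma w0_words_flip:
  "list_all (\<lambda>ws. list_all (\<lambda>k. list_all (\<lambda>x.
     list_ex (\<lambda>l. l \<noteq> k \<and> (let vs = take k ws @ x # drop k ws in take l vs @ drop (Suc l) vs \<in> set w0_words))
       [0..<7]) [1, 2, 3]) [0..<7]) w0_words"
  by code_simp

section \<open>Subwords as increasing lists of positions\<close>

lemma nths_eq_map_filter: "nths xs A = map ((!) xs) (filter (\<lambda>i. i \<in> A) [0..<length xs])"
proof -
  have "zip xs [0..<length xs] = map (\<lambda>i. (xs ! i, i)) [0..<length xs]"
    by (rule nth_equalityI) auto
  then show ?thesis
    by (simp add: nths_def filter_map o_def)
qed

lemma subseq_nths_iff:
  "subseq ws (nths xs A) \<longleftrightarrow>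
    (\<exists>ps. sorted_wrt (<) ps \<and> set ps \<subseteq> A \<inter> {..<length xs} \<and> ws = map ((!) xs) ps)"
proof
  assume "subseq ws (nths xs A)"
  then obtain N where "ws = nths (nths xs A) N"
    unfolding subseq_conv_nths by blast
  then have "ws = nths xs {i \<in> A. \<exists>j\<in>N. card {i' \<in> A. i' < i} = j}"
    by (simp only: nths_nths)
  then have "ws = map ((!) xs) (filter (\<lambda>i. i \<in> {i \<in> A. \<exists>j\<in>N. card {i' \<in> A. i' < i} = j}) [0..<length xs])"
    unfolding nths_eq_map_filter .
  moreover have "sorted_wrt (<) (filter P [0..<length xs])" for P
    by (simp add: sorted_wrt_filter)
  ultimately show "\<exists>ps. sorted_wrt (<) ps \<and> set ps \<subseteq> A \<inter> {..<length xs} \<and> ws = map ((!) xs) ps"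
    by (intro exI[of _ "filter (\<lambda>i. i \<in> {i \<in> A. \<exists>j\<in>N. card {i' \<in> A. i' < i} = j}) [0..<length xs]"]) auto
next
  assume "\<exists>ps. sorted_wrt (<) ps \<and> set ps \<subseteq> A \<inter> {..<length xs} \<and> ws = map ((!) xs) ps"
  then obtain ps where ps: "sorted_wrt (<) ps" "set ps \<subseteq> A \<inter> {..<length xs}" "ws = map ((!) xs) ps"
    by blast
  have "ps = filter (\<lambda>i. i \<in> set ps) (filter (\<lambda>i. i \<in> A) [0..<length xs])"
    using ps(1,2) by (intro strict_sorted_equal) (auto simp: sorted_wrt_filter)
  then have "subseq ps (filter (\<lambda>i. i \<in> A) [0..<length xs])"
    by (metis subseq_filter_left)
  then show "subseq ws (nths xs A)"
    unfolding ps(3) nths_eq_map_filter by (rule subseq_map)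
qed

definition has_w0_positions :: "(nat \<Rightarrow> nat) \<Rightarrow> nat set \<Rightarrow> bool" where
  "has_w0_positions L A \<longleftrightarrow> (\<exists>ps. sorted_wrt (<) ps \<and> set ps \<subseteq> A \<and> map L ps \<in> set w0_words)"

lemma subword_complex_iff:
  "I \<in> subword_complex Q \<longleftrightarrow>
    I \<subseteq> {1..length Q} \<and> has_w0_positions (\<lambda>p. Q ! (p - 1)) ({1..length Q} - I)"
proof -
  have "(\<exists>ws. subseq ws (nths Q {p. Suc p \<notin> I}) \<and> reduced_expression ws longest_element)
      \<longleftrightarrow> has_w0_positions (\<lambda>p. Q ! (p - 1)) ({1..length Q} - I)" (is "?l \<longleftrightarrow> ?r")
  proof
    assume ?l
    then obtain ps where ps: "sorted_wrt (<) ps" "set ps \<subseteq> {p. Suc p \<notin> I} \<inter> {..<length Q}"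
      "map ((!) Q) ps \<in> set w0_words"
      unfolding subseq_nths_iff reduced_expression_longest_element_iff by blast
    then show ?r
      unfolding has_w0_positions_def
      by (intro exI[of _ "map Suc ps"]) (auto simp: sorted_wrt_map o_def)
  next
    assume ?r
    then obtain ps where ps: "sorted_wrt (<) ps" "set ps \<subseteq> {1..length Q} - I"
      "map (\<lambda>p. Q ! (p - 1)) ps \<in> set w0_words"
      unfolding has_w0_positions_def by blast
    have "sorted_wrt (<) (map (\<lambda>p. p - 1) ps)"
      unfolding sorted_wrt_map using ps(2)
      by (intro sorted_wrt_mono_rel[OF _ ps(1)]) (auto simp: subset_iff)
    moreover have "set (map (\<lambda>p. p - 1) ps) \<subseteq> {p. Suc p \<notin> I} \<inter> {..<length Q}"
      using ps(2) by (auto simp: subset_iff)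
    ultimately show ?l
      unfolding subseq_nths_iff reduced_expression_longest_element_iff using ps(3)
      by (intro exI[of _ "map (\<lambda>p. Q ! (p - 1)) ps"] conjI exI[of _ "map (\<lambda>p. p - 1) ps"]) auto
  qed
  then show ?thesis by (simp add: subword_complex_def)
qed

text \<open>A word contains a reduced word of w0 iff its Demazure product lies below no coatom w0
  s_i in Bruhat order. Not lying below w0 s_i means lying above the shortest element of the coset w0
  W_J, where J consists of the other two generators. These shortest elements are s3 s2 s1, s2 s1 s3
  s2 and s1 s2 s3, for i = 1, 2, 3. The middle one has the reduced words 2132 and 2312, so
  \<open>x\<close> and \<open>z\<close> are not compared in the last clause.\<close>

definition position_pattern :: "(nat \<Rightarrow> nat) \<Rightarrow> nat set \<Rightarrow> bool" where
  "position_pattern L A \<longleftrightarrow>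
    (\<exists>x\<in>A. \<exists>y\<in>A. \<exists>z\<in>A. L x = 1 \<and> L y = 2 \<and> L z = 3 \<and> x < y \<and> y < z) \<and>
    (\<exists>x\<in>A. \<exists>y\<in>A. \<exists>z\<in>A. L x = 1 \<and> L y = 2 \<and> L z = 3 \<and> z < y \<and> y < x) \<and>
    (\<exists>y\<in>A. \<exists>x\<in>A. \<exists>z\<in>A. \<exists>w\<in>A. L y = 2 \<and> L x = 1 \<and> L z = 3 \<and> L w = 2 \<and>
      y < x \<and> y < z \<and> x < w \<and> z < w)"

lemma w0_words_pattern:
  "list_all (\<lambda>ws.
     list_ex (\<lambda>y. list_ex (\<lambda>x. list_ex (\<lambda>z. x < y \<and> y < z \<and> ws ! x = 1 \<and> ws ! y = 2 \<and> ws ! z = 3)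
       [0..<6]) [0..<6]) [0..<6] \<and>
     list_ex (\<lambda>y. list_ex (\<lambda>x. list_ex (\<lambda>z. z < y \<and> y < x \<and> ws ! x = 1 \<and> ws ! y = 2 \<and> ws ! z = 3)
       [0..<6]) [0..<6]) [0..<6] \<and>
     list_ex (\<lambda>y. ws ! y = 2 \<and> list_ex (\<lambda>x. y < x \<and> ws ! x = 1 \<and> list_ex (\<lambda>z. y < z \<and> ws ! z = 3 \<and>
       list_ex (\<lambda>w. x < w \<and> z < w \<and> ws ! w = 2) [0..<6]) [0..<6]) [0..<6]) [0..<6])
   w0_words"
  by code_simp

lemma length_w0_words: "ws \<in> set w0_words \<Longrightarrow> length ws = 6"
  using expresses_reversal_length_6 by blast

lemma position_pattern_if_has_w0_positions:
  assumes "has_w0_positions L A"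
  shows "position_pattern L A"
proof -
  obtain ps where ps: "sorted_wrt (<) ps" "set ps \<subseteq> A" "map L ps \<in> set w0_words"
    using assms by (auto simp: has_w0_positions_def)
  have len: "length ps = 6" using length_w0_words[OF ps(3)] by simp
  have less: "ps ! i < ps ! j" if "i < j" "j < 6" for i j
    using ps(1) that len by (simp add: sorted_wrt_iff_nth_less)
  have mem: "ps ! i \<in> A" if "i < 6" for i
    using ps(2) that len by (auto simp: subset_iff)
  note * = w0_words_pattern[unfolded list_all_iff list_ex_iff, rule_format, OF ps(3)]
  from * obtain x y z where
    1: "x < y" "y < z" "z < 6" "L (ps ! x) = 1" "L (ps ! y) = 2" "L (ps ! z) = 3"
    using len by auto
  from * obtain x' y' z' where
    2: "z' < y'" "y' < x'" "x' < 6" "L (ps ! x') = 1" "L (ps ! y') = 2" "L (ps ! z') = 3"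
    using len by auto
  from * obtain y'' x'' z'' w'' where
    3: "y'' < x''" "y'' < z''" "x'' < w''" "z'' < w''" "w'' < 6"
      "L (ps ! y'') = 2" "L (ps ! x'') = 1" "L (ps ! z'') = 3" "L (ps ! w'') = 2"
    using len by auto
  show ?thesis
    unfolding position_pattern_def
  proof (intro conjI)
    show "\<exists>x\<in>A. \<exists>y\<in>A. \<exists>z\<in>A. L x = 1 \<and> L y = 2 \<and> L z = 3 \<and> x < y \<and> y < z"
      by (rule bexI[of _ "ps ! x"], rule bexI[of _ "ps ! y"], rule bexI[of _ "ps ! z"])
        (use 1 mem less in auto)
    show "\<exists>x\<in>A. \<exists>y\<in>A. \<exists>z\<in>A. L x = 1 \<and> L y = 2 \<and> L z = 3 \<and> z < y \<and> y < x"
      by (rule bexI[of _ "ps ! x'"], rule bexI[of _ "ps ! y'"], rule bexI[of _ "ps ! z'"])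
        (use 2 mem less in auto)
    show "\<exists>y\<in>A. \<exists>x\<in>A. \<exists>z\<in>A. \<exists>w\<in>A. L y = 2 \<and> L x = 1 \<and> L z = 3 \<and> L w = 2 \<and>
      y < x \<and> y < z \<and> x < w \<and> z < w"
      by (rule bexI[of _ "ps ! y''"], rule bexI[of _ "ps ! x''"], rule bexI[of _ "ps ! z''"],
          rule bexI[of _ "ps ! w''"])
        (use 3 mem less in auto)
  qed
qed

text \<open>With \<open>p\<close> and \<open>q\<close> the first and the last 2, the proof distinguishes which of the letters 1
  and 3 occur before \<open>p\<close> and after \<open>q\<close>.\<close>

lemma has_w0_positions_if_position_pattern:
  assumes fin: "finite A" and pat: "position_pattern L A"
  shows "has_w0_positions L A"
proof -
  have K: ?thesis
    if "p1 \<in> A" "p2 \<in> A" "p3 \<in> A" "p4 \<in> A" "p5 \<in> A" "p6 \<in> A"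
      "p1 < p2" "p2 < p3" "p3 < p4" "p4 < p5" "p5 < p6"
      "[L p1, L p2, L p3, L p4, L p5, L p6] \<in> set w0_words" for p1 p2 p3 p4 p5 p6
    unfolding has_w0_positions_def
    by (rule exI[of _ "[p1, p2, p3, p4, p5, p6]"]) (use that in simp)
  obtain a1 a2 a3 where a: "a1 \<in> A" "a2 \<in> A" "a3 \<in> A" "L a1 = 1" "L a2 = 2" "L a3 = 3" "a1 < a2" "a2 < a3"
    using pat unfolding position_pattern_def by blast
  obtain d1 d2 d3 where d: "d1 \<in> A" "d2 \<in> A" "d3 \<in> A" "L d1 = 1" "L d2 = 2" "L d3 = 3" "d3 < d2" "d2 < d1"
    using pat unfolding position_pattern_def by blast
  obtain y x z w where b: "y \<in> A" "x \<in> A" "z \<in> A" "w \<in> A" "L y = 2" "L x = 1" "L z = 3" "L w = 2"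
      "y < x" "y < z" "x < w" "z < w"
    using pat unfolding position_pattern_def by blast
  define p q where "p = Min {y \<in> A. L y = 2}" and "q = Max {y \<in> A. L y = 2}"
  have two: "finite {y \<in> A. L y = 2}" "y \<in> {y \<in> A. L y = 2}" "w \<in> {y \<in> A. L y = 2}"
    using fin b by auto
  then have "{y \<in> A. L y = 2} \<noteq> {}" by blast
  then have "p \<in> {y \<in> A. L y = 2}" "q \<in> {y \<in> A. L y = 2}" "p \<le> y" "w \<le> q"
    unfolding p_def q_def
    using Min_in[OF two(1)] Max_in[OF two(1)] Min_le[OF two(1,2)] Max_ge[OF two(1,3)] by blast+
  then have pq: "p \<in> A" "q \<in> A" "L p = 2" "L q = 2" "p < x" "p < z" "x < q" "z < q"
    using b by auto
  have "x \<noteq> z" using b by auto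
  have "u \<noteq> p \<and> u \<noteq> q" if "L u \<noteq> 2" for u
    using that pq by auto
  then have "a1 \<noteq> p" "a3 \<noteq> q" "d3 \<noteq> p" "d1 \<noteq> q"
    using a d by auto
  then have cmp: "a1 < p \<or> p < a1" "a3 < q \<or> q < a3" "d3 < p \<or> p < d3" "d1 < q \<or> q < d1"
    by auto
  show ?thesis
  proof (cases "\<exists>u\<in>A. L u = 1 \<and> u < p")
    case True
    then obtain u where u: "u \<in> A" "L u = 1" "u < p" by blast
    \<comment> \<open>Without a 1 after \<open>q\<close> and a 3 before \<open>p\<close>, the triple
      3, 2, 1 lies between \<open>p\<close> and \<open>q\<close> and gives 1 2 3 2 1 2.\<close>
    consider v where "v \<in> A" "L v = 1" "q < v" | v where "v \<in> A" "L v = 3" "v < p"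
      | "p < d3" "d1 < q"
      using cmp d by blast
    then show ?thesis
    proof cases
      case v: (1 v)
      from \<open>x \<noteq> z\<close> consider "x < z" | "z < x" by linarith
      then show ?thesis
      proof cases
        case 1
        show ?thesis
          by (rule K[of u p x z q v]) (use 1 v u pq b in \<open>simp_all add: w0_words_def\<close>)
      next
        case 2
        show ?thesis
          by (rule K[of u p z x q v]) (use 2 v u pq b in \<open>simp_all add: w0_words_def\<close>)
      qed
    next
      case v: (2 v)
      have "u \<noteq> v" using u v by auto
      from \<open>x \<noteq> z\<close> \<open>u \<noteq> v\<close> consider "x < z" "u < v" | "x < z" "v < u" | "z < x" "u < v" | "z < x" "v < u" by linarith
      then show ?thesis
      proof cases
        case 1
        show ?thesis
          by (rule K[of u v p x z q]) (use 1 v u pq b in \<open>simp_all add: w0_words_def\<close>)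
      next
        case 2
        show ?thesis
          by (rule K[of v u p x z q]) (use 2 v u pq b in \<open>simp_all add: w0_words_def\<close>)
      next
        case 3
        show ?thesis
          by (rule K[of u v p z x q]) (use 3 v u pq b in \<open>simp_all add: w0_words_def\<close>)
      next
        case 4
        show ?thesis
          by (rule K[of v u p z x q]) (use 4 v u pq b in \<open>simp_all add: w0_words_def\<close>)
      qed
    next
      case 3
      show ?thesis
        by (rule K[of u p d3 d2 d1 q]) (use 3 u pq d in \<open>simp_all add: w0_words_def\<close>)
    qed
  next
    case no1: False
    then have "p < a1" using cmp a by blast
    show ?thesis
    proof (cases "\<exists>u\<in>A. L u = 3 \<and> u < p")
      case True
      then obtain u where u: "u \<in> A" "L u = 3" "u < p" by blast
      consider v where "v \<in> A" "L v = 3" "q < v" | "a3 < q"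
        using cmp a by blast
      then show ?thesis
      proof cases
        case v: (1 v)
        from \<open>x \<noteq> z\<close> consider "x < z" | "z < x" by linarith
        then show ?thesis
        proof cases
          case 1
          show ?thesis
            by (rule K[of u p x z q v]) (use 1 v u pq b in \<open>simp_all add: w0_words_def\<close>)
        next
          case 2
          show ?thesis
            by (rule K[of u p z x q v]) (use 2 v u pq b in \<open>simp_all add: w0_words_def\<close>)
        qed
      next
        case 2
        show ?thesis
          by (rule K[of u p a1 a2 a3 q]) (use 2 u pq a \<open>p < a1\<close> in \<open>simp_all add: w0_words_def\<close>)
      qed
    next
      case no3: False
      then have "p < d3" using cmp d by blast
      show ?thesis
      proof (cases "\<exists>u\<in>A. L u = 1 \<and> q < u")
        case True
        then obtain u where u: "u \<in> A" "L u = 1" "q < u" by blast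
        consider v where "v \<in> A" "L v = 3" "q < v" | "a3 < q"
          using cmp a by blast
        then show ?thesis
        proof cases
          case v: (1 v)
          have "u \<noteq> v" using u v by auto
          from \<open>x \<noteq> z\<close> \<open>u \<noteq> v\<close> consider "x < z" "u < v" | "x < z" "v < u" | "z < x" "u < v" | "z < x" "v < u" by linarith
          then show ?thesis
          proof cases
            case 1
            show ?thesis
              by (rule K[of p x z q u v]) (use 1 v u pq b in \<open>simp_all add: w0_words_def\<close>)
          next
            case 2
            show ?thesis
              by (rule K[of p x z q v u]) (use 2 v u pq b in \<open>simp_all add: w0_words_def\<close>)
          next
            case 3
            show ?thesis
              by (rule K[of p z x q u v]) (use 3 v u pq b in \<open>simp_all add: w0_words_def\<close>)
          next
            case 4
            show ?thesis
              by (rule K[of p z x q v u]) (use 4 v u pq b in \<open>simp_all add: w0_words_def\<close>)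
          qed
        next
          case 2
          show ?thesis
            by (rule K[of p a1 a2 a3 q u]) (use 2 u pq a \<open>p < a1\<close> in \<open>simp_all add: w0_words_def\<close>)
        qed
      next
        case no1': False
        then have "d1 < q" using cmp d by blast
        show ?thesis
        proof (cases "\<exists>u\<in>A. L u = 3 \<and> q < u")
          case True
          then obtain u where u: "u \<in> A" "L u = 3" "q < u" by blast
          show ?thesis
            by (rule K[of p d3 d2 d1 q u]) (use u pq d \<open>p < d3\<close> \<open>d1 < q\<close> in \<open>simp_all add: w0_words_def\<close>)
        next
          case False
          then have "a3 < q" using cmp a by blast
          \<comment> \<open>All letters 1 and 3 now lie between \<open>p\<close> and
            \<open>q\<close>. No reduced word both starts and ends with 2, so the word starts at
            \<open>p\<close> and ends before \<open>q\<close>. If a 2 separates the first 1 from the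
            first 3, the word is 212321 or 232123; otherwise it is 2, then 1 and 3, then 2, then 1
            and 3, each pair in the order found.\<close>
          define e1 e3 where "e1 = Min {y \<in> A. L y = 1}" and "e3 = Min {y \<in> A. L y = 3}"
          have "finite {y \<in> A. L y = 1}" "a1 \<in> {y \<in> A. L y = 1}"
            using fin a by auto
          then have "e1 \<in> {y \<in> A. L y = 1}" "e1 \<le> a1"
            unfolding e1_def using Min_in[of "{y \<in> A. L y = 1}"] Min_le[of "{y \<in> A. L y = 1}" a1] by blast+
          moreover have "finite {y \<in> A. L y = 3}" "d3 \<in> {y \<in> A. L y = 3}"
            using fin d by auto
          then have "e3 \<in> {y \<in> A. L y = 3}" "e3 \<le> d3"
            unfolding e3_def using Min_in[of "{y \<in> A. L y = 3}"] Min_le[of "{y \<in> A. L y = 3}" d3] by blast+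
          ultimately have e: "e1 \<in> A" "e3 \<in> A" "L e1 = 1" "L e3 = 3" "e1 \<le> a1" "e3 \<le> d3"
            by auto
          have "\<not> e1 < p" "\<not> e3 < p" using no1 no3 e by blast+
          moreover have "e1 \<noteq> p" "e3 \<noteq> p" using e pq by auto
          ultimately have pe: "p < e1" "p < e3" by auto
          \<comment> \<open>The smaller of the two positions precedes both \<open>a3\<close> and
            \<open>d1\<close>.\<close>
          define t where "t = min a2 d2"
          have t: "t \<in> A" "L t = 2" "t < a3" "t < d1" "t \<noteq> e1" "t \<noteq> e3"
            using a d e by (auto simp: t_def min_def)
          have "a3 \<noteq> d1" "e1 \<noteq> e3" using a d e by auto
          consider s where "s \<in> A" "L s = 2" "e1 < s" "s < e3" | s where "s \<in> A" "L s = 2" "e3 < s" "s < e1"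
            | "e1 < t" "e3 < t"
          proof -
            have "e1 < a2" "e3 < d2" using a d e by auto
            then have "e1 < t \<and> e3 < t \<or> (e1 < a2 \<and> a2 < e3) \<or> (e3 < d2 \<and> d2 < e1)"
              using t(5,6) by (auto simp: t_def min_def split: if_splits)
            then show ?thesis using that a d by blast
          qed
          then show ?thesis
          proof cases
            case (1 s)
            show ?thesis
              by (rule K[of p e1 s d3 d2 d1]) (use 1 pq d e pe in \<open>simp_all add: w0_words_def\<close>)
          next
            case (2 s)
            show ?thesis
              by (rule K[of p e3 s a1 a2 a3]) (use 2 pq a e pe in \<open>simp_all add: w0_words_def\<close>)
          next
            case et: 3
            from \<open>e1 \<noteq> e3\<close> \<open>a3 \<noteq> d1\<close> consider "e1 < e3" "a3 < d1" | "e1 < e3" "d1 < a3" | "e3 < e1" "a3 < d1" | "e3 < e1" "d1 < a3" by linarith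
            then show ?thesis
            proof cases
              case 1
              show ?thesis
                by (rule K[of p e1 e3 t a3 d1]) (use 1 et pq a d e pe t in \<open>simp_all add: w0_words_def\<close>)
            next
              case 2
              show ?thesis
                by (rule K[of p e1 e3 t d1 a3]) (use 2 et pq a d e pe t in \<open>simp_all add: w0_words_def\<close>)
            next
              case 3
              show ?thesis
                by (rule K[of p e3 e1 t a3 d1]) (use 3 et pq a d e pe t in \<open>simp_all add: w0_words_def\<close>)
            next
              case 4
              show ?thesis
                by (rule K[of p e3 e1 t d1 a3]) (use 4 et pq a d e pe t in \<open>simp_all add: w0_words_def\<close>)
            qed
          qed
        qed
      qed
    qed
  qed
qed

text \<open>Inserting \<open>e\<close> among the six positions makes seven, and the exchange
  property deletes one of them other than \<open>e\<close>.\<close>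

lemma w0_positions_flip:
  fixes L :: "'a::linorder \<Rightarrow> nat"
  assumes ps: "sorted_wrt (<) ps" "map L ps \<in> set w0_words" and e: "e \<notin> set ps" "L e \<in> {1, 2, 3}"
  obtains p qs where "p \<in> set ps" "p \<notin> set qs" "set qs \<subseteq> insert e (set ps)"
    "sorted_wrt (<) qs" "map L qs \<in> set w0_words"
proof -
  define us where "us = filter (\<lambda>x. x < e) ps"
  define vs where "vs = filter (\<lambda>x. e < x) ps"
  have "ps = us @ vs"
  proof (rule strict_sorted_equal)
    show "sorted_wrt (<) (us @ vs)"
      using ps(1) by (auto simp: us_def vs_def sorted_wrt_append sorted_wrt_filter)
    show "set ps = set (us @ vs)"
      using e(1) by (auto simp: us_def vs_def) (metis linorder_less_linear)
  qed (rule ps(1))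
  define xs where "xs = us @ e # vs"
  have sorted: "sorted_wrt (<) xs"
    using ps(1) by (auto simp: xs_def us_def vs_def sorted_wrt_append sorted_wrt_filter)
  define ws where "ws = map L ps"
  define k where "k = length us"
  have "length ws = 6" using length_w0_words[OF ps(2)] by (simp add: ws_def)
  then have len: "length us + length vs = 6" "length xs = 7"
    by (simp_all add: ws_def \<open>ps = us @ vs\<close> xs_def)
  have Lxs: "map L xs = take k ws @ L e # drop k ws"
    by (simp add: xs_def ws_def k_def \<open>ps = us @ vs\<close>)
  have "k \<in> set [0..<7]" "L e \<in> set [1, 2, 3]" "ws \<in> set w0_words"
    using len e ps by (auto simp: k_def ws_def)
  then obtain l where l: "l < 7" "l \<noteq> k"
    "take l (map L xs) @ drop (Suc l) (map L xs) \<in> set w0_words"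
    using w0_words_flip unfolding list_all_iff list_ex_iff Lxs Let_def by fastforce
  define qs where "qs = take l xs @ drop (Suc l) xs"
  have xs_split: "xs = take l xs @ xs ! l # drop (Suc l) xs"
    using l(1) len by (simp add: id_take_nth_drop)
  have dist: "distinct xs" using sorted by (simp add: strict_sorted_iff)
  have notin: "xs ! l \<notin> set qs"
    using dist unfolding qs_def by (subst (asm) xs_split) auto
  have "xs ! k = e" by (simp add: xs_def k_def)
  then have "xs ! l \<noteq> e"
    using nth_eq_iff_index_eq[OF dist, of l k] l len by (auto simp: k_def)
  moreover have "xs ! l \<in> set xs" using l len by simp
  moreover have set_xs: "set xs = insert e (set ps)" by (simp add: xs_def \<open>ps = us @ vs\<close>)
  ultimately have "xs ! l \<in> set ps" by simp
  moreover have "set qs \<subseteq> insert e (set ps)"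
    unfolding set_xs[symmetric] qs_def using set_take_subset set_drop_subset by fastforce
  moreover have "sorted_wrt (<) qs"
    using sorted unfolding qs_def by (subst (asm) xs_split) (auto simp: sorted_wrt_append)
  moreover have "map L qs \<in> set w0_words"
    using l(3) by (simp add: qs_def take_map drop_map)
  ultimately show ?thesis using that notin by blast
qed

section \<open>Subwords of powers of the Coxeter word\<close>

text \<open>The sets \<open>X1\<close>, \<open>X2\<close>, \<open>X3\<close> consist of the indices of the blocks that contribute a letter 1, 2, 3.
  As in the matrix D213, block indices decrease along the word; in a block, 2 precedes 1 and 3.\<close>

definition w0_pattern :: "nat set \<Rightarrow> nat set \<Rightarrow> nat set \<Rightarrow> bool" where
  "w0_pattern X1 X2 X3 \<longleftrightarrow>
     (\<exists>i\<in>X1. \<exists>j\<in>X2. \<exists>k\<in>X3. k \<le> j \<and> j < i) \<and>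
     (\<exists>i\<in>X1. \<exists>j\<in>X2. \<exists>k\<in>X3. i \<le> j \<and> j < k) \<and>
     (\<exists>j\<in>X2. \<exists>i\<in>X1. \<exists>k\<in>X3. \<exists>l\<in>X2. j < i \<and> j < k \<and> i \<le> l \<and> k \<le> l)"

lemma w0_patternE:
  assumes "w0_pattern X1 X2 X3"
  obtains i1 j1 k1 i2 j2 k2 i j k l where
    "i1 \<in> X1" "j1 \<in> X2" "k1 \<in> X3" "k1 \<le> j1" "j1 < i1"
    "i2 \<in> X1" "j2 \<in> X2" "k2 \<in> X3" "i2 \<le> j2" "j2 < k2"
    "i \<in> X1" "j \<in> X2" "k \<in> X3" "l \<in> X2" "j < i" "j < k" "i \<le> l" "k \<le> l"
  using assms unfolding w0_pattern_def by (elim conjE bexE)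

lemma w0_pattern_mono:
  assumes "w0_pattern X1 X2 X3" "X1 \<subseteq> Y1" "X2 \<subseteq> Y2" "X3 \<subseteq> Y3"
  shows "w0_pattern Y1 Y2 Y3"
proof -
  obtain i1 j1 k1 i2 j2 k2 i j k l where
    1: "i1 \<in> X1" "j1 \<in> X2" "k1 \<in> X3" "k1 \<le> j1" "j1 < i1" and
    2: "i2 \<in> X1" "j2 \<in> X2" "k2 \<in> X3" "i2 \<le> j2" "j2 < k2" and
    3: "i \<in> X1" "j \<in> X2" "k \<in> X3" "l \<in> X2" "j < i" "j < k" "i \<le> l" "k \<le> l"
    by (rule w0_patternE[OF assms(1)])
  note sub = subsetD[OF assms(2)] subsetD[OF assms(3)] subsetD[OF assms(4)]
  show ?thesis
    unfolding w0_pattern_def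
  proof (intro conjI)
    show "\<exists>i\<in>Y1. \<exists>j\<in>Y2. \<exists>k\<in>Y3. k \<le> j \<and> j < i"
      by (rule bexI[of _ i1], rule bexI[of _ j1], rule bexI[of _ k1]) (simp_all add: 1 sub)
    show "\<exists>i\<in>Y1. \<exists>j\<in>Y2. \<exists>k\<in>Y3. i \<le> j \<and> j < k"
      by (rule bexI[of _ i2], rule bexI[of _ j2], rule bexI[of _ k2]) (simp_all add: 2 sub)
    show "\<exists>j\<in>Y2. \<exists>i\<in>Y1. \<exists>k\<in>Y3. \<exists>l\<in>Y2. j < i \<and> j < k \<and> i \<le> l \<and> k \<le> l"
      by (rule bexI[of _ j], rule bexI[of _ i], rule bexI[of _ k], rule bexI[of _ l])
        (simp_all add: 3 sub)
  qed
qed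

section \<open>Positions of the letters block by block\<close>

definition pos1 :: "nat \<Rightarrow> nat \<Rightarrow> nat" where "pos1 m i = 3 * (m - i) + 2"
definition pos2 :: "nat \<Rightarrow> nat \<Rightarrow> nat" where "pos2 m i = 3 * (m - i) + 1"
definition pos3 :: "nat \<Rightarrow> nat \<Rightarrow> nat" where "pos3 m i = 3 * (m - i) + 3"

lemmas pos_defs = pos1_def pos2_def pos3_def

lemma pos_in_range:
  assumes "i \<in> {1..m}"
  shows "pos1 m i \<in> {1..3 * m}" "pos2 m i \<in> {1..3 * m}" "pos3 m i \<in> {1..3 * m}"
  using assms by (auto simp: pos_defs)

lemma pos_exhaust:
  assumes "p \<in> {1..3 * m}"
  obtains i where "i \<in> {1..m}" "p = pos1 m i" | i where "i \<in> {1..m}" "p = pos2 m i"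
    | i where "i \<in> {1..m}" "p = pos3 m i"
proof -
  define i where "i = m - (p - 1) div 3"
  have "p = 3 * ((p - 1) div 3) + (p - 1) mod 3 + 1" "(p - 1) div 3 < m"
    using assms by auto
  then have "i \<in> {1..m}" "p = 3 * (m - i) + (p - 1) mod 3 + 1"
    by (auto simp: i_def)
  moreover consider "(p - 1) mod 3 = 0" | "(p - 1) mod 3 = 1" | "(p - 1) mod 3 = 2"
    by linarith
  then show ?thesis
  proof cases
    case 1
    then show ?thesis using calculation that(2)[of i] by (simp add: pos_defs)
  next
    case 2
    then show ?thesis using calculation that(1)[of i] by (simp add: pos_defs)
  next
    case 3
    then show ?thesis using calculation that(3)[of i] by (simp add: pos_defs)
  qed
qed

lemma length_c213_power: "length (c213_power m) = 3 * m"
  by (induction m) (simp_all add: c213_power_def)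

lemma nth_c213_power: "q < 3 * m \<Longrightarrow> c213_power m ! q = [2, 1, 3] ! (q mod 3)"
proof (induction m arbitrary: q)
  case (Suc m)
  have *: "c213_power (Suc m) = [2, 1, 3] @ c213_power m" by (simp add: c213_power_def)
  show ?case
  proof (cases "q < 3")
    case True
    then show ?thesis unfolding * nth_append by simp
  next
    case False
    then have "c213_power (Suc m) ! q = c213_power m ! (q - 3)" unfolding * nth_append by (simp add: numeral_3_eq_3)
    also have "\<dots> = [2, 1, 3] ! ((q - 3) mod 3)" using Suc False by simp
    also have "(q - 3) mod 3 = q mod 3" using False by (simp add: le_mod_geq)
    finally show ?thesis .
  qed
qed simp

lemma pos_div_mod:
  "(pos1 m i - Suc 0) div 3 = m - i" "(pos2 m i - Suc 0) div 3 = m - i" "(pos3 m i - Suc 0) div 3 = m - i"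
  "(pos1 m i - Suc 0) mod 3 = 1" "(pos2 m i - Suc 0) mod 3 = 0" "(pos3 m i - Suc 0) mod 3 = 2"
proof -
  have *: "(r + n * 3) div 3 = n" "(r + n * 3) mod 3 = r" if "r < 3" for r n :: nat
    using that by simp_all
  have "pos1 m i - Suc 0 = 1 + (m - i) * 3" "pos2 m i - Suc 0 = 0 + (m - i) * 3"
    "pos3 m i - Suc 0 = 2 + (m - i) * 3"
    by (simp_all add: pos_defs)
  then show
    "(pos1 m i - Suc 0) div 3 = m - i" "(pos2 m i - Suc 0) div 3 = m - i" "(pos3 m i - Suc 0) div 3 = m - i"
    "(pos1 m i - Suc 0) mod 3 = 1" "(pos2 m i - Suc 0) mod 3 = 0" "(pos3 m i - Suc 0) mod 3 = 2"
    by (simp_all only: *)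
qed

lemma c213_power_pos:
  assumes "i \<in> {1..m}"
  shows "c213_power m ! (pos1 m i - Suc 0) = 1" "c213_power m ! (pos2 m i - Suc 0) = 2"
    "c213_power m ! (pos3 m i - Suc 0) = 3"
proof -
  have "p - Suc 0 < 3 * m" if "p \<in> {1..3 * m}" for p
    using that by auto
  from this[OF pos_in_range(1)[OF assms]] this[OF pos_in_range(2)[OF assms]]
    this[OF pos_in_range(3)[OF assms]]
  show "c213_power m ! (pos1 m i - Suc 0) = 1" "c213_power m ! (pos2 m i - Suc 0) = 2"
    "c213_power m ! (pos3 m i - Suc 0) = 3"
    by (simp_all add: nth_c213_power pos_div_mod)
qed

definition index_set :: "(nat \<Rightarrow> nat \<Rightarrow> nat) \<Rightarrow> nat \<Rightarrow> nat set \<Rightarrow> nat set" where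
  "index_set pos m A = {i \<in> {1..m}. pos m i \<in> A}"

lemma letter_positions:
  assumes "A \<subseteq> {1..3 * m}"
  shows "{p \<in> A. c213_power m ! (p - 1) = 1} = pos1 m ` index_set pos1 m A"
    "{p \<in> A. c213_power m ! (p - 1) = 2} = pos2 m ` index_set pos2 m A"
    "{p \<in> A. c213_power m ! (p - 1) = 3} = pos3 m ` index_set pos3 m A"
proof -
  have "p \<in> pos1 m ` index_set pos1 m A" if "p \<in> A" "c213_power m ! (p - 1) = 1" for p
    using subsetD[OF assms that(1)] that
    by (cases p m rule: pos_exhaust) (auto simp: c213_power_pos index_set_def)
  moreover have "p \<in> pos2 m ` index_set pos2 m A" if "p \<in> A" "c213_power m ! (p - 1) = 2" for p
    using subsetD[OF assms that(1)] that
    by (cases p m rule: pos_exhaust) (auto simp: c213_power_pos index_set_def)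
  moreover have "p \<in> pos3 m ` index_set pos3 m A" if "p \<in> A" "c213_power m ! (p - 1) = 3" for p
    using subsetD[OF assms that(1)] that
    by (cases p m rule: pos_exhaust) (auto simp: c213_power_pos index_set_def)
  ultimately show
    "{p \<in> A. c213_power m ! (p - 1) = 1} = pos1 m ` index_set pos1 m A"
    "{p \<in> A. c213_power m ! (p - 1) = 2} = pos2 m ` index_set pos2 m A"
    "{p \<in> A. c213_power m ! (p - 1) = 3} = pos3 m ` index_set pos3 m A"
    by (auto simp: c213_power_pos index_set_def)
qed

lemma position_pattern_iff:
  "position_pattern L A \<longleftrightarrow>
    (let X1 = {p \<in> A. L p = 1}; X2 = {p \<in> A. L p = 2}; X3 = {p \<in> A. L p = 3} in
    (\<exists>x\<in>X1. \<exists>y\<in>X2. \<exists>z\<in>X3. x < y \<and> y < z) \<and>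
    (\<exists>x\<in>X1. \<exists>y\<in>X2. \<exists>z\<in>X3. z < y \<and> y < x) \<and>
    (\<exists>y\<in>X2. \<exists>x\<in>X1. \<exists>z\<in>X3. \<exists>w\<in>X2. y < x \<and> y < z \<and> x < w \<and> z < w))"
  unfolding position_pattern_def Let_def
  by (intro arg_cong2[of _ _ _ _ conj]) blast+

lemma pos_less_iff:
  assumes "i \<in> {1..m}" "j \<in> {1..m}"
  shows "pos1 m i < pos2 m j \<longleftrightarrow> j < i" "pos2 m j < pos1 m i \<longleftrightarrow> i \<le> j"
    "pos3 m i < pos2 m j \<longleftrightarrow> j < i" "pos2 m j < pos3 m i \<longleftrightarrow> i \<le> j"
  using assms by (auto simp: pos_defs)

lemma position_pattern_c213_power:
  assumes "A \<subseteq> {1..3 * m}"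
  shows "position_pattern (\<lambda>p. c213_power m ! (p - 1)) A \<longleftrightarrow>
    w0_pattern (index_set pos1 m A) (index_set pos2 m A) (index_set pos3 m A)"
    (is "_ \<longleftrightarrow> w0_pattern ?X1 ?X2 ?X3")
proof -
  have X: "i \<in> {1..m}" if "i \<in> ?X1 \<or> i \<in> ?X2 \<or> i \<in> ?X3" for i
    using that by (auto simp: index_set_def)
  note less = pos_less_iff[OF X X]
  have "(\<exists>x\<in>?X1. \<exists>y\<in>?X2. \<exists>z\<in>?X3. pos1 m x < pos2 m y \<and> pos2 m y < pos3 m z) \<longleftrightarrow>
      (\<exists>i\<in>?X1. \<exists>j\<in>?X2. \<exists>k\<in>?X3. k \<le> j \<and> j < i)"
    by (intro bex_cong refl) (simp add: less conj_commute)
  moreover have "(\<exists>x\<in>?X1. \<exists>y\<in>?X2. \<exists>z\<in>?X3. pos3 m z < pos2 m y \<and> pos2 m y < pos1 m x) \<longleftrightarrow>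
      (\<exists>i\<in>?X1. \<exists>j\<in>?X2. \<exists>k\<in>?X3. i \<le> j \<and> j < k)"
    by (intro bex_cong refl) (simp add: less conj_commute)
  \<comment> \<open>Block indices decrease along the word, so the first 2 has the larger index:
    \<open>y\<close> and \<open>w\<close> turn into \<open>l\<close> and \<open>j\<close>.\<close>
  moreover have "(\<exists>y\<in>?X2. \<exists>x\<in>?X1. \<exists>z\<in>?X3. \<exists>w\<in>?X2. pos2 m y < pos1 m x \<and> pos2 m y < pos3 m z \<and>
        pos1 m x < pos2 m w \<and> pos3 m z < pos2 m w) \<longleftrightarrow>
      (\<exists>l\<in>?X2. \<exists>i\<in>?X1. \<exists>k\<in>?X3. \<exists>j\<in>?X2. j < i \<and> j < k \<and> i \<le> l \<and> k \<le> l)"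
    by (intro bex_cong refl) (auto simp add: less)
  moreover have "\<dots> \<longleftrightarrow> (\<exists>j\<in>?X2. \<exists>i\<in>?X1. \<exists>k\<in>?X3. \<exists>l\<in>?X2. j < i \<and> j < k \<and> i \<le> l \<and> k \<le> l)"
    by blast
  ultimately show ?thesis
    unfolding position_pattern_iff letter_positions[OF assms] Let_def bex_simps w0_pattern_def
    by argo
qed

lemma subword_complex_c213_positions:
  "I \<in> subword_complex (c213_power m) \<longleftrightarrow>
    I \<subseteq> {1..3 * m} \<and> has_w0_positions (\<lambda>p. c213_power m ! (p - 1)) ({1..3 * m} - I)"
  by (simp add: subword_complex_iff length_c213_power)

lemma subword_complex_c213_iff:
  "I \<in> subword_complex (c213_power m) \<longleftrightarrow> I \<subseteq> {1..3 * m} \<and>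
    w0_pattern ({1..m} - index_set pos1 m I) ({1..m} - index_set pos2 m I) ({1..m} - index_set pos3 m I)"
proof -
  have "index_set pos1 m ({1..3 * m} - I) = {1..m} - index_set pos1 m I"
    "index_set pos2 m ({1..3 * m} - I) = {1..m} - index_set pos2 m I"
    "index_set pos3 m ({1..3 * m} - I) = {1..m} - index_set pos3 m I"
    using pos_in_range by (auto simp: index_set_def)
  then have "position_pattern (\<lambda>p. c213_power m ! (p - 1)) ({1..3 * m} - I) \<longleftrightarrow>
      w0_pattern ({1..m} - index_set pos1 m I) ({1..m} - index_set pos2 m I) ({1..m} - index_set pos3 m I)"
    using position_pattern_c213_power[of "{1..3 * m} - I" m] by (simp only: Diff_subset)
  moreover have "has_w0_positions (\<lambda>p. c213_power m ! (p - 1)) ({1..3 * m} - I) \<longleftrightarrow>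
      position_pattern (\<lambda>p. c213_power m ! (p - 1)) ({1..3 * m} - I)"
    using position_pattern_if_has_w0_positions has_w0_positions_if_position_pattern by blast
  ultimately show ?thesis
    unfolding subword_complex_c213_positions by (simp only:)
qed

section \<open>Purity and flips of the subword complex\<close>

lemma c213_face_facet:
  assumes "I \<in> subword_complex (c213_power m)"
  obtains ps where "sorted_wrt (<) ps" "map (\<lambda>p. c213_power m ! (p - 1)) ps \<in> set w0_words"
    "set ps \<subseteq> {1..3 * m} - I" "card (set ps) = 6"
proof -
  obtain ps where ps: "sorted_wrt (<) ps" "set ps \<subseteq> {1..3 * m} - I"
      "map (\<lambda>p. c213_power m ! (p - 1)) ps \<in> set w0_words"
    using assms by (auto simp: subword_complex_c213_positions has_w0_positions_def)
  have "distinct ps" using ps(1) by (simp add: strict_sorted_iff)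
  then have "card (set ps) = 6"
    using length_w0_words[OF ps(3)] by (simp add: distinct_card)
  with ps that show ?thesis by blast
qed

text \<open>Of the complement keep only the six positions of one reduced word; all other positions
  form a facet.\<close>

lemma c213_complex_pure:
  assumes "I \<in> subword_complex (c213_power m)"
  shows "\<exists>F\<in>subword_complex (c213_power m). I \<subseteq> F \<and> card F = 3 * m - 6"
proof -
  obtain ps where ps: "sorted_wrt (<) ps" "map (\<lambda>p. c213_power m ! (p - 1)) ps \<in> set w0_words"
    "set ps \<subseteq> {1..3 * m} - I" "card (set ps) = 6"
    using c213_face_facet[OF assms] .
  have I: "I \<subseteq> {1..3 * m}" using assms by (simp add: subword_complex_c213_positions)
  have "{1..3 * m} - set ps \<in> subword_complex (c213_power m)"
    unfolding subword_complex_c213_positions has_w0_positions_def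
    using ps by (auto intro!: exI[of _ ps])
  moreover have "card ({1..3 * m} - set ps) = 3 * m - 6"
    using ps(3,4) by (subst card_Diff_subset) auto
  ultimately show ?thesis using I ps(3) by blast
qed

text \<open>The complement of a facet is a single reduced word. Moving \<open>e\<close> into it
  makes seven positions, and the one that the exchange property deletes is the new vertex
  \<open>p\<close>.\<close>

lemma c213_complex_flip:
  assumes F: "F \<in> subword_complex (c213_power m)" "card F = 3 * m - 6" and m: "m \<ge> 2" and e: "e \<in> F"
  shows "\<exists>p. p \<notin> F \<and> insert p (F - {e}) \<in> subword_complex (c213_power m)"
proof -
  let ?L = "\<lambda>p. c213_power m ! (p - 1)"
  obtain ps where ps: "sorted_wrt (<) ps" "map ?L ps \<in> set w0_words"
    "set ps \<subseteq> {1..3 * m} - F" "card (set ps) = 6"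
    using c213_face_facet[OF F(1)] .
  have F': "F \<subseteq> {1..3 * m}" using F by (simp add: subword_complex_c213_positions)
  \<comment> \<open>\<open>m \<ge> 2\<close> makes the truncated subtraction
    \<open>3 * m - 6\<close> exact.\<close>
  then have "card ({1..3 * m} - F) = 6"
    using F(2) m by (subst card_Diff_subset) (auto intro: finite_subset)
  then have set_ps: "set ps = {1..3 * m} - F"
    using ps(3,4) by (intro card_subset_eq) auto
  have "?L e \<in> {1, 2, 3}"
    using subsetD[OF F' e] by (cases e m rule: pos_exhaust) (auto simp: c213_power_pos)
  moreover have "e \<notin> set ps" using e set_ps by auto
  ultimately obtain p qs where pq: "p \<in> set ps" "p \<notin> set qs" "set qs \<subseteq> insert e (set ps)"
      "sorted_wrt (<) qs" "map ?L qs \<in> set w0_words"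
    using w0_positions_flip[OF ps(1,2)] by metis
  have "insert p (F - {e}) \<in> subword_complex (c213_power m)"
    unfolding subword_complex_c213_positions has_w0_positions_def
  proof (intro conjI exI[of _ qs])
    show "insert p (F - {e}) \<subseteq> {1..3 * m}" using F' pq(1) set_ps by auto
    show "set qs \<subseteq> {1..3 * m} - insert p (F - {e})"
      using pq(1-3) set_ps F' e by auto
  qed (use pq in auto)
  moreover have "p \<notin> F" using pq(1) set_ps by auto
  ultimately show ?thesis by blast
qed

section \<open>Sign patterns of the row space\<close>

text \<open>Here \<open>A i\<close> stands for \<open>a i + 1 / 2\<close>, which makes the signature inequalities homogeneous.\<close>

locale interlacing =
  fixes m :: nat and A b c :: "nat \<Rightarrow> real"
  assumes mono_A: "\<lbrakk>1 \<le> i; i < j; j \<le> m\<rbrakk> \<Longrightarrow> A i < A j"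
    and mono_b: "\<lbrakk>1 \<le> i; i < j; j \<le> m\<rbrakk> \<Longrightarrow> b i < b j"
    and mono_c: "\<lbrakk>1 \<le> i; i < j; j \<le> m\<rbrakk> \<Longrightarrow> c i < c j"
    and upper: "\<lbrakk>i \<in> {1..m}; j \<in> {1..m}; i \<noteq> j\<rbrakk> \<Longrightarrow> 2 * A i - b i - c i + (2 * A j - b j - c j) > 0"
    and lower: "\<lbrakk>Suc i \<in> {2..m}; Suc j \<in> {2..m}; i \<noteq> j\<rbrakk> \<Longrightarrow>
        b (Suc i) + c (Suc i) - 2 * A i + (b (Suc j) + c (Suc j) - 2 * A j) > 0"
begin

lemma le_b: "\<lbrakk>1 \<le> i; i \<le> j; j \<le> m\<rbrakk> \<Longrightarrow> b i \<le> b j"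
  and le_c: "\<lbrakk>1 \<le> i; i \<le> j; j \<le> m\<rbrakk> \<Longrightarrow> c i \<le> c j"
  using mono_b[of i j] mono_c[of i j] by (cases "i = j"; simp)+

lemma le_if_A: "\<lbrakk>A i \<le> A j; i \<in> {1..m}; j \<in> {1..m}\<rbrakk> \<Longrightarrow> i \<le> j"
  and le_if_b: "\<lbrakk>b i \<le> b j; i \<in> {1..m}; j \<in> {1..m}\<rbrakk> \<Longrightarrow> i \<le> j"
  and le_if_c: "\<lbrakk>c i \<le> c j; i \<in> {1..m}; j \<in> {1..m}\<rbrakk> \<Longrightarrow> i \<le> j"
  using mono_A[of j i] mono_b[of j i] mono_c[of j i] by force+

text \<open>The automorphism of the Coxeter diagram exchanges the letters 1 and 3, so every estimate
  relating 2 to 1 also relates 2 to 3.\<close>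

lemma swap: "interlacing m A c b"
  using mono_A mono_b mono_c upper lower by unfold_locales (auto simp: algebra_simps)

text \<open>Since \<open>A\<close> and \<open>b\<close> both increase with the index, the threshold
  conditions close the cycle j' \<le> j \<le> i < i' \<le> j'.\<close>

lemma no_crossing_up:
  assumes "i \<in> {1..m}" "j \<in> {1..m}" "i < i'" "i' \<le> m" "j' \<in> {1..m}" "j' \<le> j"
    and "A i \<ge> s" "b i' \<le> t" "A j \<le> s" "b j' \<ge> t"
  shows False
proof -
  have "j \<le> i" using assms le_if_A[of j i] by simp
  moreover have "i' \<le> j'" using assms le_if_b[of i' j'] by simp
  ultimately show False using assms by simp
qed

lemma no_crossing_down:
  assumes "i \<in> {1..m}" "j \<in> {1..m}" "i' \<le> i" "i' \<in> {1..m}" "j' \<le> m" "j < j'"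
    and "A i \<le> s" "b i' \<ge> t" "A j \<ge> s" "b j' \<le> t"
  shows False
proof -
  have "i \<le> j" using assms le_if_A[of i j] by simp
  moreover have "j' \<le> i'" using assms le_if_b[of j' i'] by simp
  ultimately show False using assms by simp
qed

text \<open>The witnesses are 123 and 321 from \<open>pos\<close> and the third subword from
  \<open>neg\<close>. The 2s of the former lie at or beyond s2 or -s2; the 1 and the 3 of the latter
  lie at or beyond s1, s3 or their negatives. Monotonicity leaves two combinations of sides. In
  each, one signature expression is at most +-(s1 + s3 - 2 s2) at one index and at most the opposite
  value at another, so the sum is <= 0, against \<open>lower\<close> or
  \<open>upper\<close>.\<close>

lemma no_two_signs_quadratic:
  assumes s: "s1 \<ge> 0" "s2 \<ge> 0" "s3 \<ge> 0"
    and pos: "w0_pattern {i\<in>{1..m}. \<bar>b i\<bar> \<le> s1} {i\<in>{1..m}. \<bar>A i\<bar> \<ge> s2} {i\<in>{1..m}. \<bar>c i\<bar> \<le> s3}"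
    and neg: "w0_pattern {i\<in>{1..m}. \<bar>b i\<bar> \<ge> s1} {i\<in>{1..m}. \<bar>A i\<bar> \<le> s2} {i\<in>{1..m}. \<bar>c i\<bar> \<ge> s3}"
  shows False
proof -
  interpret sw: interlacing m A c b by (rule swap)
  let ?P1 = "{i\<in>{1..m}. \<bar>b i\<bar> \<le> s1}" and ?P2 = "{i\<in>{1..m}. \<bar>A i\<bar> \<ge> s2}" and ?P3 = "{i\<in>{1..m}. \<bar>c i\<bar> \<le> s3}"
  let ?N1 = "{i\<in>{1..m}. \<bar>b i\<bar> \<ge> s1}" and ?N2 = "{i\<in>{1..m}. \<bar>A i\<bar> \<le> s2}" and ?N3 = "{i\<in>{1..m}. \<bar>c i\<bar> \<ge> s3}"
  obtain i1 j1 k1 i2 j2 k2 where p: "i1 \<in> ?P1" "j1 \<in> ?P2" "k1 \<in> ?P3" "k1 \<le> j1" "j1 < i1"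
      "i2 \<in> ?P1" "j2 \<in> ?P2" "k2 \<in> ?P3" "i2 \<le> j2" "j2 < k2"
    by (rule w0_patternE[OF pos])
  obtain i j k l where q: "i \<in> ?N1" "j \<in> ?N2" "k \<in> ?N3" "l \<in> ?N2" "j < i" "j < k" "i \<le> l" "k \<le> l"
    by (rule w0_patternE[OF neg])
  have p1: "i1 \<in> {1..m}" "j1 \<in> {1..m}" "k1 \<in> {1..m}" "k1 \<le> j1" "j1 < i1"
      "\<bar>b i1\<bar> \<le> s1" "\<bar>A j1\<bar> \<ge> s2" "\<bar>c k1\<bar> \<le> s3"
    and p2: "i2 \<in> {1..m}" "j2 \<in> {1..m}" "k2 \<in> {1..m}" "i2 \<le> j2" "j2 < k2"
      "\<bar>b i2\<bar> \<le> s1" "\<bar>A j2\<bar> \<ge> s2" "\<bar>c k2\<bar> \<le> s3"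
    using p by blast+
  have n: "i \<in> {1..m}" "j \<in> {1..m}" "k \<in> {1..m}" "l \<in> {1..m}"
      "j < i" "j < k" "i \<le> l" "k \<le> l" "\<bar>b i\<bar> \<ge> s1" "\<bar>A j\<bar> \<le> s2" "\<bar>c k\<bar> \<ge> s3" "\<bar>A l\<bar> \<le> s2"
    using q by blast+
  have P: "- s1 \<le> b i1" "b i1 \<le> s1" "- s3 \<le> c k1" "c k1 \<le> s3"
      "- s1 \<le> b i2" "b i2 \<le> s1" "- s3 \<le> c k2" "c k2 \<le> s3"
      "- s2 \<le> A j" "A j \<le> s2" "- s2 \<le> A l" "A l \<le> s2"
    using p1(6,8) p2(6,8) n(10,12) by (simp_all only: abs_le_iff minus_le_iff)
  have q1: "A j1 \<ge> s2 \<or> A j1 \<le> - s2" and q2: "A j2 \<ge> s2 \<or> A j2 \<le> - s2"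
    and qi: "b i \<ge> s1 \<or> b i \<le> - s1" and qk: "c k \<ge> s3 \<or> c k \<le> - s3"
    using p1(7) p2(7) n(9,11) by linarith+
  note n = n(1-8) and p1 = p1(1-5) and p2 = p2(1-5)
  \<comment> \<open>Each excluded combination closes a cycle of index inequalities; for
    \<open>e1\<close> it is i \<le> l \<le> j1 < i1 \<le> i.\<close>
  have e1: "\<not> (A j1 \<ge> s2 \<and> b i \<ge> s1)"
    using no_crossing_up[of j1 l i1 i s2 s1] p1 n P by fastforce
  have e2: "\<not> (A j2 \<ge> s2 \<and> c k \<ge> s3)"
    using sw.no_crossing_up[of j2 l k2 k s2 s3] p2 n P by fastforce
  have e3: "\<not> (A j2 \<le> - s2 \<and> b i \<le> - s1)"
    using no_crossing_down[of j2 j i2 i "- s2" "- s1"] p2 n P by fastforce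
  have e4: "\<not> (A j1 \<le> - s2 \<and> c k \<le> - s3)"
    using sw.no_crossing_down[of j1 j k1 k "- s2" "- s3"] p1 n P by fastforce
  consider "A j1 \<ge> s2" "A j2 \<ge> s2" "b i \<le> - s1" "c k \<le> - s3"
    | "A j1 \<le> - s2" "A j2 \<le> - s2" "b i \<ge> s1" "c k \<ge> s3"
    using q1 q2 qi qk e1 e2 e3 e4 by blast
  then show False
  proof cases
    case 1
    \<comment> \<open>The minimum puts \<open>Suc h\<close> below both \<open>i1\<close> and
      \<open>k2\<close>, so \<open>b (Suc h)\<close> and \<open>c (Suc h)\<close> are bounded at
      once.\<close>
    define h where "h = min j1 j2"
    have h: "h \<in> {1..m}" "Suc h \<in> {2..m}" "Suc h \<le> i1" "Suc h \<le> k2" "A h \<ge> s2"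
      using p1 p2 1 by (simp_all add: h_def min_def)
    have "b (Suc h) \<le> b i1" "c (Suc h) \<le> c k2"
      using h p1 p2 by (auto intro!: le_b le_c)
    moreover have "b (Suc j) \<le> b i" "c (Suc j) \<le> c k"
      using n by (auto intro!: le_b le_c)
    ultimately have "b (Suc h) + c (Suc h) - 2 * A h + (b (Suc j) + c (Suc j) - 2 * A j) \<le> 0"
      using 1 P h(5) by linarith
    \<comment> \<open>From \<open>A j < A l\<close> and \<open>A l \<le> s2 \<le> A h\<close> the
      indices \<open>h\<close> and \<open>j\<close> differ, as \<open>lower\<close>
      requires.\<close>
    moreover have "A j < A l"
      using mono_A[of j l] n by simp
    then have "h \<noteq> j"
      using P h(5) by auto
    ultimately show False
      using lower[of h j] h(1,2) n by auto
  next
    case 2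
    \<comment> \<open>Dually, the maximum lies above both \<open>i2\<close> and
      \<open>k1\<close>.\<close>
    define h where "h = max j1 j2"
    have h: "h \<in> {1..m}" "k1 \<le> h" "i2 \<le> h" "A h \<le> - s2"
      using p1 p2 2 by (simp_all add: h_def max_def)
    have "b i2 \<le> b h" "c k1 \<le> c h"
      using h p1 p2 by (auto intro!: le_b le_c)
    moreover have "b i \<le> b l" "c k \<le> c l"
      using n by (auto intro!: le_b le_c)
    ultimately have "2 * A h - b h - c h + (2 * A l - b l - c l) \<le> 0"
      using 2 P h(4) by linarith
    moreover have "A j < A l"
      using mono_A[of j l] n by simp
    then have "h \<noteq> l"
      using P h(4) by auto
    ultimately show False
      using upper[of h l] h(1) n by auto
  qed
qed

text \<open>The translation changes 2A - b - c by q + r - 2p = 0 and leaves the order of each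
  sequence alone.\<close>

lemma shift: "p + p = q + r \<Longrightarrow> interlacing m (\<lambda>i. A i - p) (\<lambda>i. b i - q) (\<lambda>i. c i - r)"
proof unfold_locales
  fix i j assume *: "p + p = q + r" "i \<in> {1..m}" "j \<in> {1..m}" "i \<noteq> j"
  show "0 < 2 * (A i - p) - (b i - q) - (c i - r) + (2 * (A j - p) - (b j - q) - (c j - r))"
    using upper[OF *(2-4)] *(1) by (simp add: algebra_simps)
next
  fix i j assume *: "p + p = q + r" "Suc i \<in> {2..m}" "Suc j \<in> {2..m}" "i \<noteq> j"
  show "0 < b (Suc i) - q + (c (Suc i) - r) - 2 * (A i - p) + (b (Suc j) - q + (c (Suc j) - r) - 2 * (A j - p))"
    using lower[OF *(2-4)] *(1) by (simp add: algebra_simps)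
qed (use mono_A mono_b mono_c in auto)

lemma no_two_signs_positive:
  fixes \<alpha> l1 l2 l3 k1 k2 k3 :: real
  defines "F1 \<equiv> \<lambda>i. - (\<alpha> / 2) * (b i)\<^sup>2 + l1 * b i + k1"
    and "F2 \<equiv> \<lambda>i. \<alpha> * (A i)\<^sup>2 + l2 * A i + k2"
    and "F3 \<equiv> \<lambda>i. - (\<alpha> / 2) * (c i)\<^sup>2 + l3 * c i + k3"
  assumes \<alpha>: "\<alpha> > 0" and l: "l1 + l2 + l3 = 0"
    and pos: "w0_pattern {i\<in>{1..m}. F1 i \<ge> 0} {i\<in>{1..m}. F2 i \<ge> 0} {i\<in>{1..m}. F3 i \<ge> 0}"
    and neg: "w0_pattern {i\<in>{1..m}. F1 i \<le> 0} {i\<in>{1..m}. F2 i \<le> 0} {i\<in>{1..m}. F3 i \<le> 0}"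
  shows False
proof -
  \<comment> \<open>\<open>p\<close>, \<open>q\<close>, \<open>r\<close> are the vertices of the
    three parabolas; the relation between the slopes is exactly p + p = q + r.\<close>
  define p q r where "p = - l2 / (2 * \<alpha>)" and "q = l1 / \<alpha>" and "r = l3 / \<alpha>"
  define e1 e2 e3 where "e1 = q\<^sup>2 + 2 * k1 / \<alpha>" and "e2 = p\<^sup>2 - k2 / \<alpha>" and "e3 = r\<^sup>2 + 2 * k3 / \<alpha>"
  have "l2 = - (l1 + l3)" using l by simp
  then have "p + p = q + r"
    using \<alpha> by (simp add: p_def q_def r_def field_simps)
  then interpret sh: interlacing m "\<lambda>i. A i - p" "\<lambda>i. b i - q" "\<lambda>i. c i - r"
    by (rule shift)
  have F1: "F1 i = \<alpha> / 2 * (e1 - (b i - q)\<^sup>2)" and F2: "F2 i = \<alpha> * ((A i - p)\<^sup>2 - e2)"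
    and F3: "F3 i = \<alpha> / 2 * (e3 - (c i - r)\<^sup>2)" for i
    using \<alpha> by (simp_all add: F1_def F2_def F3_def e1_def e2_def e3_def p_def q_def r_def
        power2_eq_square field_simps)
  have s1: "F1 i \<ge> 0 \<longleftrightarrow> (b i - q)\<^sup>2 \<le> e1" "F1 i \<le> 0 \<longleftrightarrow> e1 \<le> (b i - q)\<^sup>2"
    and s2: "F2 i \<ge> 0 \<longleftrightarrow> e2 \<le> (A i - p)\<^sup>2" "F2 i \<le> 0 \<longleftrightarrow> (A i - p)\<^sup>2 \<le> e2"
    and s3: "F3 i \<ge> 0 \<longleftrightarrow> (c i - r)\<^sup>2 \<le> e3" "F3 i \<le> 0 \<longleftrightarrow> e3 \<le> (c i - r)\<^sup>2" for i
    using \<alpha> by (simp_all add: F1 F2 F3 zero_le_mult_iff mult_le_0_iff)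
  obtain i1 k1' where "i1 \<in> {i\<in>{1..m}. F1 i \<ge> 0}" "k1' \<in> {i\<in>{1..m}. F3 i \<ge> 0}"
    by (rule w0_patternE[OF pos])
  moreover obtain j1 where "j1 \<in> {i\<in>{1..m}. F2 i \<le> 0}"
    by (rule w0_patternE[OF neg])
  \<comment> \<open>Each of \<open>e1\<close>, \<open>e2\<close>, \<open>e3\<close> bounds a square
    from above at some witness: \<open>F1\<close> and \<open>F3\<close> are >= 0 somewhere,
    \<open>F2\<close> is <= 0 somewhere. Hence their square roots can serve as thresholds.\<close>
  ultimately have e: "e1 \<ge> 0" "e2 \<ge> 0" "e3 \<ge> 0"
    unfolding mem_Collect_eq s1 s2 s3 by (meson order_trans zero_le_power2)+
  have sq: "x\<^sup>2 \<le> e \<longleftrightarrow> \<bar>x\<bar> \<le> sqrt e" "e \<le> x\<^sup>2 \<longleftrightarrow> sqrt e \<le> \<bar>x\<bar>" if "e \<ge> 0" for x e :: real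
    by (metis real_sqrt_abs real_sqrt_le_iff)+
  show False
    using pos neg unfolding s1 s2 s3 sq[OF e(1)] sq[OF e(2)] sq[OF e(3)]
    by (intro sh.no_two_signs_quadratic[of "sqrt e1" "sqrt e2" "sqrt e3"]) (simp_all add: e)
qed

text \<open>With slopes of opposite signs, comparing the values at 2 gives j' \<le> j and those at 1
  give i \<le> i'. The cycle j' \<le> j < i \<le> i' \<le> j' is contradictory.\<close>

lemma linear_not_opposite:
  fixes l1 l2 k1 k2 :: real
  assumes "l2 > 0" "l1 < 0" "i \<in> {1..m}" "j \<in> {1..m}" "i' \<in> {1..m}" "j' \<in> {1..m}"
    and "j < i" "l1 * b i + k1 \<ge> 0" "l2 * A j + k2 \<ge> 0"
    and "i' \<le> j'" "l1 * b i' + k1 \<le> 0" "l2 * A j' + k2 \<le> 0"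
  shows False
proof -
  have "l2 * A j' \<le> l2 * A j" "l1 * b i' \<le> l1 * b i" using assms by linarith+
  then have "A j' \<le> A j" "b i \<le> b i'" using assms(1,2) by auto
  then have "j' \<le> j" "i \<le> i'" using assms le_if_A le_if_b by auto
  then show False using assms by simp
qed

lemma linear_not_opposite_outer:
  fixes l1 l3 k1 k3 :: real
  assumes "l1 > 0" "l3 < 0" "i \<in> {1..m}" "k \<in> {1..m}" "i' \<in> {1..m}" "k' \<in> {1..m}"
    and "i < k" "l1 * b i + k1 \<ge> 0" "l3 * c k + k3 \<ge> 0"
    and "k' < i'" "l1 * b i' + k1 \<le> 0" "l3 * c k' + k3 \<le> 0"
  shows False
proof -
  have "l1 * b i' \<le> l1 * b i" "l3 * c k' \<le> l3 * c k" using assms by linarith+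
  then have "b i' \<le> b i" "c k \<le> c k'" using assms(1,2) by auto
  then have "i' \<le> i" "k \<le> k'" using assms le_if_b le_if_c by auto
  then show False using assms by simp
qed

text \<open>The slope at 2 can have neither slope at 1 nor slope at 3 of opposite sign. As the
  slopes sum to 0, it vanishes, and the other two are opposite, which the comparison of 1 with 3
  also forbids unless they are 0.\<close>

lemma two_signs_linear:
  fixes l1 l2 l3 k1 k2 k3 :: real
  defines "F1 \<equiv> \<lambda>i. l1 * b i + k1"
    and "F2 \<equiv> \<lambda>i. l2 * A i + k2"
    and "F3 \<equiv> \<lambda>i. l3 * c i + k3"
  assumes l: "l1 + l2 + l3 = 0"
    and pos: "w0_pattern {i\<in>{1..m}. F1 i \<ge> 0} {i\<in>{1..m}. F2 i \<ge> 0} {i\<in>{1..m}. F3 i \<ge> 0}"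
    and neg: "w0_pattern {i\<in>{1..m}. F1 i \<le> 0} {i\<in>{1..m}. F2 i \<le> 0} {i\<in>{1..m}. F3 i \<le> 0}"
  shows "F1 i = 0 \<and> F2 i = 0 \<and> F3 i = 0"
proof -
  interpret sw: interlacing m A c b by (rule swap)
  let ?P1 = "{i\<in>{1..m}. F1 i \<ge> 0}" and ?P2 = "{i\<in>{1..m}. F2 i \<ge> 0}" and ?P3 = "{i\<in>{1..m}. F3 i \<ge> 0}"
  let ?N1 = "{i\<in>{1..m}. F1 i \<le> 0}" and ?N2 = "{i\<in>{1..m}. F2 i \<le> 0}" and ?N3 = "{i\<in>{1..m}. F3 i \<le> 0}"
  obtain i1 j1 k1' i2 j2 k2' where p: "i1 \<in> ?P1" "j1 \<in> ?P2" "k1' \<in> ?P3" "k1' \<le> j1" "j1 < i1"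
      "i2 \<in> ?P1" "j2 \<in> ?P2" "k2' \<in> ?P3" "i2 \<le> j2" "j2 < k2'"
    by (rule w0_patternE[OF pos])
  obtain i3 j3 k3' i4 j4 k4' where n: "i3 \<in> ?N1" "j3 \<in> ?N2" "k3' \<in> ?N3" "k3' \<le> j3" "j3 < i3"
      "i4 \<in> ?N1" "j4 \<in> ?N2" "k4' \<in> ?N3" "i4 \<le> j4" "j4 < k4'"
    by (rule w0_patternE[OF neg])
  note pn = p[unfolded mem_Collect_eq F1_def F2_def F3_def] n[unfolded mem_Collect_eq F1_def F2_def F3_def]
  have "\<not> (l2 > 0 \<and> l1 < 0)"
    using linear_not_opposite[of l2 l1 i1 j1 i4 j4 k1 k2] pn by blast
  moreover have "\<not> (l2 < 0 \<and> l1 > 0)"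
    using linear_not_opposite[of "- l2" "- l1" i3 j3 i2 j2 "- k1" "- k2"] pn by auto
  moreover have "\<not> (l2 > 0 \<and> l3 < 0)"
    using sw.linear_not_opposite[of l2 l3 k2' j2 k3' j3 k3 k2] pn by blast
  moreover have "\<not> (l2 < 0 \<and> l3 > 0)"
    using sw.linear_not_opposite[of "- l2" "- l3" k4' j4 k1' j1 "- k3" "- k2"] pn by auto
  ultimately have "l2 = 0" using l by linarith
  then have l3: "l3 = - l1" using l by simp
  have "\<not> l1 > 0"
    using linear_not_opposite_outer[of l1 l3 i2 k2' i3 k3' k1 k3] pn l3 by auto
  moreover have "\<not> l1 < 0"
    using linear_not_opposite_outer[of "- l1" "- l3" i4 k4' i1 k1' "- k1" "- k3"] pn l3 by auto
  ultimately have "l1 = 0" by linarith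
  \<comment> \<open>All three functions are constant, and each is >= 0 at one witness and <= 0 at
    another.\<close>
  then show ?thesis
    using \<open>l2 = 0\<close> l3 p n by (simp add: F1_def F2_def F3_def)
qed

lemma two_signs:
  fixes \<alpha> l1 l2 l3 k1 k2 k3 :: real
  defines "F1 \<equiv> \<lambda>i. - (\<alpha> / 2) * (b i)\<^sup>2 + l1 * b i + k1"
    and "F2 \<equiv> \<lambda>i. \<alpha> * (A i)\<^sup>2 + l2 * A i + k2"
    and "F3 \<equiv> \<lambda>i. - (\<alpha> / 2) * (c i)\<^sup>2 + l3 * c i + k3"
  assumes l: "l1 + l2 + l3 = 0"
    and pos: "w0_pattern {i\<in>{1..m}. F1 i \<ge> 0} {i\<in>{1..m}. F2 i \<ge> 0} {i\<in>{1..m}. F3 i \<ge> 0}"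
    and neg: "w0_pattern {i\<in>{1..m}. F1 i \<le> 0} {i\<in>{1..m}. F2 i \<le> 0} {i\<in>{1..m}. F3 i \<le> 0}"
  shows "F1 i = 0 \<and> F2 i = 0 \<and> F3 i = 0"
proof -
  have "\<not> \<alpha> > 0"
    using no_two_signs_positive[OF _ l] pos neg unfolding F1_def F2_def F3_def by blast
  moreover have "\<not> \<alpha> < 0"
  proof
    \<comment> \<open>Negating all coefficients exchanges the hypotheses \<open>pos\<close> and
      \<open>neg\<close>.\<close>
    assume "\<alpha> < 0"
    have eq: "- (- \<alpha> / 2) * (b i)\<^sup>2 + - l1 * b i + - k1 = - F1 i"
      "- \<alpha> * (A i)\<^sup>2 + - l2 * A i + - k2 = - F2 i"
      "- (- \<alpha> / 2) * (c i)\<^sup>2 + - l3 * c i + - k3 = - F3 i" for i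
      by (simp_all add: F1_def F2_def F3_def)
    show False
      by (rule no_two_signs_positive[of "- \<alpha>" "- l1" "- l2" "- l3" "- k1" "- k2" "- k3"], unfold eq)
        (use \<open>\<alpha> < 0\<close> l pos neg in simp_all)
  qed
  ultimately have "\<alpha> = 0" by linarith
  then show ?thesis
    using two_signs_linear[OF l, of k1 k2 k3 i] pos neg by (simp add: F1_def F2_def F3_def)
qed

end

section \<open>From the matrix to quadratic functions\<close>

lemma c213_signature_interlacing:
  assumes "c213_signature_inequalities m a b c"
  shows "interlacing m (\<lambda>i. a i + 1 / 2) b c"
proof -
  have step: "a i < a (Suc i) \<and> b i < b (Suc i) \<and> c i < c (Suc i)" if "1 \<le> i" "Suc i \<le> m" for i
    using assms that unfolding c213_signature_inequalities_def
    by (auto dest!: bspec[of _ _ "Suc i"])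
  have mono: "a i < a j \<and> b i < b j \<and> c i < c j" if "1 \<le> i" "i < j" "j \<le> m" for i j
    using that(2,1,3)
  proof (induction rule: less_Suc_induct)
    case (2 i j k)
    then show ?case by force
  qed (use step in auto)
  show ?thesis
  proof unfold_locales
    fix i j assume "i \<in> {1..m}" "j \<in> {1..m}" "i \<noteq> j"
    then have "2 * a i - b i - c i + 2 * a j - b j - c j + 2 > 0"
      using assms unfolding c213_signature_inequalities_def by blast
    then show "0 < 2 * (a i + 1 / 2) - b i - c i + (2 * (a j + 1 / 2) - b j - c j)"
      by simp
  next
    fix i j assume *: "Suc i \<in> {2..m}" "Suc j \<in> {2..m}" "i \<noteq> j"
    then have "b (Suc i) + c (Suc i) - 2 * a (Suc i - 1) + b (Suc j) + c (Suc j) - 2 * a (Suc j - 1) - 2 > 0"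
      using assms unfolding c213_signature_inequalities_def by (metis Suc_inject)
    then show "0 < b (Suc i) + c (Suc i) - 2 * (a i + 1 / 2) + (b (Suc j) + c (Suc j) - 2 * (a j + 1 / 2))"
      by simp
  qed (use mono in auto)
qed

lemma vector_6:
  "(vector [u, v, w, x, y, z] :: 'a::zero^6) $ 1 = u" "(vector [u, v, w, x, y, z] :: 'a^6) $ 2 = v"
  "(vector [u, v, w, x, y, z] :: 'a^6) $ 3 = w" "(vector [u, v, w, x, y, z] :: 'a^6) $ 4 = x"
  "(vector [u, v, w, x, y, z] :: 'a^6) $ 5 = y" "(vector [u, v, w, x, y, z] :: 'a^6) $ 6 = z"
  unfolding vector_def by simp_all

lemma sum_6: "sum f (UNIV :: 6 set) = f 1 + f 2 + f 3 + f 4 + f 5 + f 6"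
proof -
  have "x = 1 \<or> x = 2 \<or> x = 3 \<or> x = 4 \<or> x = 5 \<or> x = 6" for x :: 6
  proof (induct x)
    case (of_int z)
    then have "z = 0 \<or> z = 1 \<or> z = 2 \<or> z = 3 \<or> z = 4 \<or> z = 5" by fastforce
    then show ?case by auto
  qed
  then have U: "(UNIV :: 6 set) = {1, 2, 3, 4, 5, 6}" by auto
  show ?thesis unfolding U by (simp add: ac_simps)
qed

lemma D213_column:
  fixes y :: "real^6" and j :: "'r::{finite,linorder}"
  assumes "i \<in> {1..m}"
  shows "position j = pos1 m i \<Longrightarrow> (\<Sum>t\<in>UNIV. y $ t * (D213 m a b c :: real^'r::{finite,linorder}^6) $ t $ j) =
      y $ 2 * (m - b i + 1) + y $ 4 * (((real m + 1) gchoose 2) - (b i gchoose 2)) + y $ 6"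
    and "position j = pos2 m i \<Longrightarrow> (\<Sum>t\<in>UNIV. y $ t * (D213 m a b c :: real^'r::{finite,linorder}^6) $ t $ j) =
      y $ 1 + y $ 2 * a i + y $ 3 * a i + y $ 4 * (a i)\<^sup>2"
    and "position j = pos3 m i \<Longrightarrow> (\<Sum>t\<in>UNIV. y $ t * (D213 m a b c :: real^'r::{finite,linorder}^6) $ t $ j) =
      y $ 3 * (m - c i + 1) + y $ 4 * (((real m + 1) gchoose 2) - (c i gchoose 2)) + y $ 5"
  using assms
  by (simp_all add: sum_6 D213_def D213_block_def vector_6 pos_div_mod Let_def)

text \<open>The kernel of B is the orthogonal complement of the span of its rows, which is the
  kernel of A; and the complement of the kernel of A is the row space of A.\<close>

lemma gale_dual_relation:
  assumes "gale_dual A B" "B *v x = 0"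
  obtains y where "\<And>j. x $ j = (\<Sum>t\<in>UNIV. y $ t * A $ t $ j)"
proof -
  let ?K = "{z. A *v z = 0}"
  have span: "span (rows B) = ?K" using assms(1) by (simp add: gale_dual_def)
  have "orthogonal z x" if "z \<in> ?K" for z
    using that unfolding span[symmetric]
  proof (rule orthogonal_to_span[THEN orthogonal_commute[THEN iffD1], of z "rows B" x])
    fix r assume "r \<in> rows B"
    then obtain i where "r = row i B" by (auto simp: rows_def)
    moreover have "(B *v x) $ i = 0" using assms(2) by simp
    ultimately show "orthogonal x r"
      by (simp add: orthogonal_def matrix_vector_mul_component inner_commute row_def)
  qed
  then have "x \<in> orthogonal_comp ?K"
    by (auto simp: orthogonal_comp_def)
  also have "?K = orthogonal_comp (range (\<lambda>y. transpose A *v y))"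
    using ker_orthogonal_comp_adjoint[of "\<lambda>z. A *v z"] by (simp add: adjoint_matrix vimage_def)
  also have "orthogonal_comp \<dots> = range (\<lambda>y. transpose A *v y)"
    by (intro orthogonal_comp_self linear_subspace_image matrix_vector_mul_linear subspace_UNIV)
  finally obtain y where "x = transpose A *v y" by blast
  then have "x $ j = (\<Sum>t\<in>UNIV. y $ t * A $ t $ j)" for j
    by (simp add: matrix_vector_mult_def transpose_def mult.commute)
  then show ?thesis using that by blast
qed

lemma sum_column_at:
  fixes M :: "real^'r::{finite,linorder}^'d"
  shows "(\<Sum>p\<in>{1..CARD('r)}. h p *\<^sub>R column_at M p) = M *v (\<chi> j. h (position j))"
proof -
  have inj: "inj (position :: 'r \<Rightarrow> nat)"
    using bij_betw_position by (rule bij_betw_imp_inj_on)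
  have "(\<Sum>p\<in>{1..CARD('r)}. h p *\<^sub>R column_at M p) =
      (\<Sum>j\<in>(UNIV :: 'r set). h (position j) *\<^sub>R column_at M (position j))"
    by (rule sum.reindex_bij_betw[OF bij_betw_position[where 'r = 'r],
          of "\<lambda>p. h p *\<^sub>R column_at M p", symmetric])
  also have "\<dots> = M *v (\<chi> j. h (position j))"
    unfolding matrix_mult_sum
    by (intro sum.cong refl) (simp add: column_at_def inv_f_f[OF inj] scalar_mult_eq_scaleR)
  finally show ?thesis .
qed

lemma gchoose_2: "x gchoose 2 = x * (x - 1) / 2" for x :: real
  by (simp add: numeral_2_eq_2 gbinomial_Suc)

text \<open>A linear dependence \<open>h\<close> of the columns of M is a row space vector of D,
  hence given by the quadratics of \<open>two_signs\<close>; its six free parameters match the six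
  coordinates of \<open>y\<close>.\<close>

lemma two_signs_D213:
  fixes M :: "real^'r::{finite,linorder}^'d" and h :: "nat \<Rightarrow> real"
  assumes card: "CARD('r) = 3 * m" and sig: "c213_signature_inequalities m a b c"
    and gale: "gale_dual (D213 m a b c) M"
    and sum: "(\<Sum>p\<in>{1..3 * m}. h p *\<^sub>R column_at M p) = 0"
    and pos: "w0_pattern {i\<in>{1..m}. h (pos1 m i) \<ge> 0} {i\<in>{1..m}. h (pos2 m i) \<ge> 0} {i\<in>{1..m}. h (pos3 m i) \<ge> 0}"
    and neg: "w0_pattern {i\<in>{1..m}. h (pos1 m i) \<le> 0} {i\<in>{1..m}. h (pos2 m i) \<le> 0} {i\<in>{1..m}. h (pos3 m i) \<le> 0}"
    and p: "p \<in> {1..3 * m}"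
  shows "h p = 0"
proof -
  have "M *v (\<chi> j. h (position j)) = 0"
    using sum by (simp add: sum_column_at[symmetric] card)
  then obtain y where y: "\<And>j. h (position j) = (\<Sum>t\<in>UNIV. y $ t * (D213 m a b c :: real^'r::{finite,linorder}^6) $ t $ j)"
    using gale_dual_relation[OF gale, of "\<chi> j. h (position j)"] by auto
  have pos_ex: "\<exists>j :: 'r. position j = q" if "q \<in> {1..3 * m}" for q
    using bij_betw_imp_surj_on[OF bij_betw_position[where 'r = 'r]] that card by (metis imageE)
  let ?C = "(real m + 1) gchoose 2"
  \<comment> \<open>The summand \<alpha>/2 in \<open>l1\<close> and \<open>l3\<close> comes from the
    linear term of \<open>b gchoose 2\<close> and \<open>c gchoose 2\<close>. Expanding around a +
    1/2 produces the -\<alpha> in \<open>l2\<close> and the corrections in \<open>k2\<close>; thus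
    the slopes sum to 0.\<close>
  define \<alpha> where "\<alpha> = y $ 4"
  define l1 where "l1 = \<alpha> / 2 - y $ 2"
  define l2 where "l2 = y $ 2 + y $ 3 - \<alpha>"
  define l3 where "l3 = \<alpha> / 2 - y $ 3"
  define k1 where "k1 = y $ 2 * (m + 1) + \<alpha> * ?C + y $ 6"
  define k2 where "k2 = y $ 1 - (y $ 2 + y $ 3) / 2 + \<alpha> / 4"
  define k3 where "k3 = y $ 3 * (m + 1) + \<alpha> * ?C + y $ 5"
  have h1: "h (pos1 m i) = - (\<alpha> / 2) * (b i)\<^sup>2 + l1 * b i + k1" if i: "i \<in> {1..m}" for i
  proof -
    obtain j :: 'r where j: "position j = pos1 m i" using pos_ex pos_in_range(1)[OF i] by blast
    show ?thesis
      using y[of j] unfolding D213_column(1)[OF i j] unfolding j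
      by (simp add: gchoose_2[of "b i"] \<alpha>_def l1_def k1_def power2_eq_square field_simps)
  qed
  have h2: "h (pos2 m i) = \<alpha> * (a i + 1 / 2)\<^sup>2 + l2 * (a i + 1 / 2) + k2" if i: "i \<in> {1..m}" for i
  proof -
    obtain j :: 'r where j: "position j = pos2 m i" using pos_ex pos_in_range(2)[OF i] by blast
    show ?thesis
      using y[of j] unfolding D213_column(2)[OF i j] unfolding j
      by (simp add: \<alpha>_def l2_def k2_def power2_eq_square field_simps)
  qed
  have h3: "h (pos3 m i) = - (\<alpha> / 2) * (c i)\<^sup>2 + l3 * c i + k3" if i: "i \<in> {1..m}" for i
  proof -
    obtain j :: 'r where j: "position j = pos3 m i" using pos_ex pos_in_range(3)[OF i] by blast
    show ?thesis
      using y[of j] unfolding D213_column(3)[OF i j] unfolding j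
      by (simp add: gchoose_2[of "c i"] \<alpha>_def l3_def k3_def power2_eq_square field_simps)
  qed
  interpret interlacing m "\<lambda>i. a i + 1 / 2" b c
    using sig by (rule c213_signature_interlacing)
  have "l1 + l2 + l3 = 0" by (simp add: l1_def l2_def l3_def)
  note signs = two_signs[OF this, of \<alpha> k1 k2 k3]
  have zero: "h (pos1 m i) = 0 \<and> h (pos2 m i) = 0 \<and> h (pos3 m i) = 0" if i: "i \<in> {1..m}" for i
    unfolding h1[OF i] h2[OF i] h3[OF i]
    using pos neg by (intro signs) (simp_all add: h1 h2 h3 cong: conj_cong)
  show ?thesis
    using p zero by (cases p m rule: pos_exhaust) auto
qed

section \<open>Complete fans from unique representations\<close>

lemma cone_of_eq:
  assumes "finite I"
  shows "cone_of V I = {\<Sum>i\<in>I. u i *\<^sub>R V i | u. \<forall>i\<in>I. 0 \<le> u i}" (is "_ = ?R")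
proof
  show "?R \<subseteq> cone_of V I"
  proof
    fix x assume "x \<in> ?R"
    then obtain u where u: "x = (\<Sum>i\<in>I. u i *\<^sub>R V i)" "\<forall>i\<in>I. 0 \<le> u i" by blast
    have "J \<subseteq> I \<Longrightarrow> (\<Sum>i\<in>J. u i *\<^sub>R V i) \<in> cone_of V I" for J
    proof (induction J rule: infinite_finite_induct)
      case (insert j J)
      then show ?case
        using u(2) unfolding cone_of_def
        by (simp add: convex_cone_hull_add convex_cone_hull_mul hull_inc)
    qed (simp_all add: cone_of_def convex_cone_hull_contains_0)
    with u show "x \<in> cone_of V I" by simp
  qed
  show "cone_of V I \<subseteq> ?R"
    unfolding cone_of_def
  proof (rule hull_minimal)
    show "V ` I \<subseteq> ?R"
    proof
      fix x assume "x \<in> V ` I"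
      then obtain j where "j \<in> I" "x = V j" by blast
      with assms show "x \<in> ?R"
        by (intro CollectI exI[of _ "\<lambda>i. if i = j then 1 else 0"])
           (simp add: if_distrib[of "\<lambda>c. c *\<^sub>R _"] cong: if_cong)
    qed
    have "x + y \<in> ?R" if "x \<in> ?R" "y \<in> ?R" for x y
    proof -
      from that obtain u w where "x = (\<Sum>i\<in>I. u i *\<^sub>R V i)" "\<forall>i\<in>I. 0 \<le> u i"
        "y = (\<Sum>i\<in>I. w i *\<^sub>R V i)" "\<forall>i\<in>I. 0 \<le> w i" by blast
      then show ?thesis
        by (intro CollectI exI[of _ "\<lambda>i. u i + w i"]) (simp add: scaleR_add_left sum.distrib)
    qed
    moreover have "c *\<^sub>R x \<in> ?R" if "x \<in> ?R" "0 \<le> c" for x c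
    proof -
      from that obtain u where "x = (\<Sum>i\<in>I. u i *\<^sub>R V i)" "\<forall>i\<in>I. 0 \<le> u i" by blast
      with \<open>0 \<le> c\<close> show ?thesis
        by (intro CollectI exI[of _ "\<lambda>i. c * u i"]) (simp add: scaleR_sum_right)
    qed
    moreover have "0 \<in> ?R"
      by (intro CollectI exI[of _ "\<lambda>i. 0"]) simp
    ultimately show "convex_cone ?R"
      unfolding convex_cone_iff by blast
  qed
qed

text \<open>The hypothesis \<open>unique\<close> says that no point has two different nonnegative representations
  supported on faces. It also forces the two facets at a ridge to lie on opposite sides of it.\<close>

locale unique_representation_complex =
  fixes \<Delta> :: "'i set set" and N :: "'i set" and V :: "'i \<Rightarrow> 'v::euclidean_space"
  assumes finite_N: "finite N"
    and face_subset: "I \<in> \<Delta> \<Longrightarrow> I \<subseteq> N"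
    and subface: "I \<in> \<Delta> \<Longrightarrow> J \<subseteq> I \<Longrightarrow> J \<in> \<Delta>"
    and nonempty: "\<Delta> \<noteq> {}"
    and pure: "I \<in> \<Delta> \<Longrightarrow> \<exists>F\<in>\<Delta>. I \<subseteq> F \<and> card F = DIM('v)"
    and flip: "F \<in> \<Delta> \<Longrightarrow> card F = DIM('v) \<Longrightarrow> e \<in> F \<Longrightarrow> \<exists>p. p \<notin> F \<and> insert p (F - {e}) \<in> \<Delta>"
    and unique: "\<lbrakk>\<forall>i. 0 \<le> f i; \<forall>i. 0 \<le> g i; {i. f i \<noteq> 0} \<in> \<Delta>; {i. g i \<noteq> 0} \<in> \<Delta>;
      (\<Sum>i\<in>N. f i *\<^sub>R V i) = (\<Sum>i\<in>N. g i *\<^sub>R V i)\<rbrakk> \<Longrightarrow> f = g"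
begin

lemma finite_face: "I \<in> \<Delta> \<Longrightarrow> finite I"
  using finite_N face_subset finite_subset by blast

lemma finite_complex: "finite \<Delta>"
proof -
  have "\<Delta> \<subseteq> Pow N" using face_subset by blast
  then show ?thesis using finite_N finite_subset by blast
qed

lemma sum_face:
  assumes "I \<in> \<Delta>" "{i. f i \<noteq> 0} \<subseteq> I"
  shows "(\<Sum>i\<in>N. f i *\<^sub>R V i) = (\<Sum>i\<in>I. f i *\<^sub>R V i)"
  using assms face_subset finite_N by (intro sum.mono_neutral_right) auto

text \<open>Extending coefficients by 0 to all of \<open>N\<close> makes representations over
  different faces comparable by \<open>unique\<close>.\<close>

lemma mem_cone_iff:
  assumes "I \<in> \<Delta>"
  shows "x \<in> cone_of V I \<longleftrightarrow>
    (\<exists>f. (\<forall>i. 0 \<le> f i) \<and> {i. f i \<noteq> 0} \<subseteq> I \<and> x = (\<Sum>i\<in>N. f i *\<^sub>R V i))"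
proof
  assume "x \<in> cone_of V I"
  then obtain u where u: "x = (\<Sum>i\<in>I. u i *\<^sub>R V i)" "\<forall>i\<in>I. 0 \<le> u i"
    using cone_of_eq[OF finite_face[OF assms], of V] by blast
  define f where "f i = (if i \<in> I then u i else 0)" for i
  have sup: "{i. f i \<noteq> 0} \<subseteq> I" by (auto simp: f_def)
  have "(\<Sum>i\<in>I. u i *\<^sub>R V i) = (\<Sum>i\<in>I. f i *\<^sub>R V i)"
    by (rule sum.cong) (simp_all add: f_def)
  then have "x = (\<Sum>i\<in>N. f i *\<^sub>R V i)"
    unfolding sum_face[OF assms sup] u(1) .
  moreover have "\<forall>i. 0 \<le> f i" using u(2) by (simp add: f_def)
  ultimately show "\<exists>f. (\<forall>i. 0 \<le> f i) \<and> {i. f i \<noteq> 0} \<subseteq> I \<and> x = (\<Sum>i\<in>N. f i *\<^sub>R V i)"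
    using sup by (intro exI[of _ f]) simp
next
  assume "\<exists>f. (\<forall>i. 0 \<le> f i) \<and> {i. f i \<noteq> 0} \<subseteq> I \<and> x = (\<Sum>i\<in>N. f i *\<^sub>R V i)"
  then obtain f where f: "\<forall>i. 0 \<le> f i" "{i. f i \<noteq> 0} \<subseteq> I" "x = (\<Sum>i\<in>N. f i *\<^sub>R V i)"
    by blast
  then show "x \<in> cone_of V I"
    unfolding cone_of_eq[OF finite_face[OF assms], of V] sum_face[OF assms f(2)]
    by (intro CollectI exI[of _ f]) simp
qed

text \<open>The positive and the negative part of a relation are two nonnegative representations of
  one point. By \<open>unique\<close> they agree, and having disjoint supports they vanish.\<close>

lemma coefficients_zero:
  assumes "I \<in> \<Delta>" "(\<Sum>i\<in>I. u i *\<^sub>R V i) = 0" "j \<in> I"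
  shows "u j = 0"
proof -
  define f where "f i = (if i \<in> I then max (u i) 0 else 0)" for i
  define g where "g i = (if i \<in> I then max (- u i) 0 else 0)" for i
  have sup: "{i. f i \<noteq> 0} \<subseteq> I" "{i. g i \<noteq> 0} \<subseteq> I" by (auto simp: f_def g_def)
  have "(\<Sum>i\<in>N. f i *\<^sub>R V i) - (\<Sum>i\<in>N. g i *\<^sub>R V i) = (\<Sum>i\<in>I. u i *\<^sub>R V i)"
    unfolding sum_face[OF assms(1) sup(1)] sum_face[OF assms(1) sup(2)] sum_subtractf[symmetric]
    by (intro sum.cong) (auto simp: f_def g_def max_def)
  then have "f = g"
    using assms(1,2) sup subface by (intro unique) (auto simp: f_def g_def)
  then have "f j = g j" by simp
  with assms(3) show ?thesis by (auto simp: f_def g_def max_def split: if_splits)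
qed

lemma inj_on_face:
  assumes "I \<in> \<Delta>" shows "inj_on V I"
proof (rule inj_onI, rule ccontr)
  fix i j assume ij: "i \<in> I" "j \<in> I" "V i = V j" "i \<noteq> j"
  let ?u = "\<lambda>k. (if k = i then 1 else 0) - (if k = j then 1 else (0::real))"
  have "(\<Sum>k\<in>I. ?u k *\<^sub>R V k) = V i - V j"
    using ij finite_face[OF assms]
    by (simp add: scaleR_diff_left sum_subtractf if_distrib[of "\<lambda>c. c *\<^sub>R _"] cong: if_cong)
  then show False
    using coefficients_zero[OF assms, of ?u i] ij by auto
qed

lemma independent_face:
  assumes "I \<in> \<Delta>" shows "independent (V ` I)"
proof (rule independent_if_scalars_zero)
  fix f x assume "(\<Sum>x\<in>V ` I. f x *\<^sub>R x) = 0" "x \<in> V ` I"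
  then show "f x = 0"
    using coefficients_zero[OF assms, of "f \<circ> V"]
    by (auto simp: sum.reindex[OF inj_on_face[OF assms]] o_def)
qed (use finite_face[OF assms] in simp)

lemma cone_Int:
  assumes "I \<in> \<Delta>" "J \<in> \<Delta>"
  shows "cone_of V I \<inter> cone_of V J = cone_of V (I \<inter> J)"
proof
  have IJ: "I \<inter> J \<in> \<Delta>" using assms subface by blast
  show "cone_of V (I \<inter> J) \<subseteq> cone_of V I \<inter> cone_of V J"
    unfolding cone_of_def by (simp add: hull_mono image_mono)
  show "cone_of V I \<inter> cone_of V J \<subseteq> cone_of V (I \<inter> J)"
  proof
    fix x assume "x \<in> cone_of V I \<inter> cone_of V J"
    then obtain f g where
      f: "\<forall>i. 0 \<le> f i" "{i. f i \<noteq> 0} \<subseteq> I" "x = (\<Sum>i\<in>N. f i *\<^sub>R V i)" and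
      g: "\<forall>i. 0 \<le> g i" "{i. g i \<noteq> 0} \<subseteq> J" "x = (\<Sum>i\<in>N. g i *\<^sub>R V i)"
      using mem_cone_iff[OF assms(1)] mem_cone_iff[OF assms(2)] by blast
    have "f = g"
      using f g assms subface by (intro unique) auto
    with f g show "x \<in> cone_of V (I \<inter> J)"
      unfolding mem_cone_iff[OF IJ] by blast
  qed
qed

text \<open>The only representation of the generator \<open>V i\<close> has coefficient 1 at
  \<open>i\<close> and 0 elsewhere, so a face whose cone contains \<open>V i\<close> contains
  \<open>i\<close>.\<close>

lemma cone_subset_iff:
  assumes "I \<in> \<Delta>" "J \<in> \<Delta>"
  shows "cone_of V I \<subseteq> cone_of V J \<longleftrightarrow> I \<subseteq> J"
proof
  assume sub: "cone_of V I \<subseteq> cone_of V J"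
  show "I \<subseteq> J"
  proof
    fix i assume "i \<in> I"
    let ?f = "\<lambda>k. if k = i then 1 else (0::real)"
    have i: "i \<in> N" using \<open>i \<in> I\<close> assms face_subset by blast
    have Vi: "(\<Sum>k\<in>N. ?f k *\<^sub>R V k) = V i"
      using i finite_N by (simp add: if_distrib[of "\<lambda>c. c *\<^sub>R _"] cong: if_cong)
    have "V i \<in> cone_of V I"
      using \<open>i \<in> I\<close> by (simp add: cone_of_def hull_inc)
    then obtain g where g: "\<forall>i. 0 \<le> g i" "{i. g i \<noteq> 0} \<subseteq> J" "V i = (\<Sum>i\<in>N. g i *\<^sub>R V i)"
      using sub mem_cone_iff[OF assms(2)] by blast
    have "?f = g"
    proof (rule unique)
      have "{k. ?f k \<noteq> 0} \<subseteq> I" using \<open>i \<in> I\<close> by auto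
      then show "{k. ?f k \<noteq> 0} \<in> \<Delta>" using assms subface by blast
    qed (use g Vi assms subface in auto)
    then have "g i = 1" by auto
    with g(2) show "i \<in> J" by auto
  qed
qed (simp add: cone_of_def hull_mono image_mono)

text \<open>The generators of a facet form a basis. Linearity of the coordinates is what later turns
  positivity conditions into open sets.\<close>

lemma facet_coordinates:
  assumes "F \<in> \<Delta>" "card F = DIM('v)"
  obtains c where "\<And>i. linear (c i)" "\<And>x. x = (\<Sum>i\<in>F. c i x *\<^sub>R V i)"
    "\<And>u i. i \<in> F \<Longrightarrow> c i (\<Sum>i\<in>F. u i *\<^sub>R V i) = u i"
proof -
  have ind: "independent (V ` F)" and inj: "inj_on V F"
    using assms independent_face inj_on_face by auto
  have "card (V ` F) = DIM('v)"
    using card_image[OF inj] assms by simp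
  then have span: "span (V ` F) = UNIV"
    using ind card_ge_dim_independent[of "V ` F" UNIV] by (simp add: dim_UNIV top.extremum_unique)
  define c where "c i x = representation (V ` F) x (V i)" for i x
  have lin: "linear (c i)" for i
    unfolding c_def using ind span
    by (intro linearI) (simp_all add: representation_add representation_scale)
  have rep: "x = (\<Sum>i\<in>F. c i x *\<^sub>R V i)" for x
  proof -
    have "(\<Sum>b\<in>V ` F. representation (V ` F) x b *\<^sub>R b) = x"
      using ind span finite_face[OF assms(1)] by (intro sum_representation_eq) auto
    then show ?thesis
      by (simp add: sum.reindex[OF inj] c_def)
  qed
  have "c i (\<Sum>i\<in>F. u i *\<^sub>R V i) = u i" if "i \<in> F" for u i
  proof -
    let ?x = "\<Sum>i\<in>F. u i *\<^sub>R V i"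
    have "(\<Sum>i\<in>F. (c i ?x - u i) *\<^sub>R V i) = 0"
      using rep[of ?x] by (simp add: scaleR_diff_left sum_subtractf)
    from coefficients_zero[OF assms(1) this that] show ?thesis by simp
  qed
  with lin rep that show ?thesis by blast
qed

section \<open>Interiors at facets and ridges, and completeness\<close>

lemma open_linear_positive:
  fixes h :: "'a \<Rightarrow> 'v \<Rightarrow> real"
  assumes "finite A" "\<And>i. i \<in> A \<Longrightarrow> linear (h i)"
  shows "open {z. \<forall>i\<in>A. 0 < h i z}"
proof -
  have "{z. \<forall>i\<in>A. 0 < h i z} = (\<Inter>i\<in>A. {z. 0 < h i z})" by auto
  moreover have "open {z. 0 < h i z}" if "i \<in> A" for i
    using assms(2)[OF that] linear_continuous_on[of "h i" UNIV]
    by (intro open_Collect_less) (auto simp: linear_conv_bounded_linear)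
  ultimately show ?thesis using assms(1) by (simp add: open_INT)
qed

lemma facet_interior:
  assumes F: "F \<in> \<Delta>" "card F = DIM('v)" and u: "\<forall>i\<in>F. 0 < u i"
  shows "(\<Sum>i\<in>F. u i *\<^sub>R V i) \<in> interior (\<Union>(fan_cones \<Delta> V))"
proof -
  obtain c where c: "\<And>i. linear (c i)" "\<And>x. x = (\<Sum>i\<in>F. c i x *\<^sub>R V i)"
      "\<And>u i. i \<in> F \<Longrightarrow> c i (\<Sum>i\<in>F. u i *\<^sub>R V i) = u i"
    using facet_coordinates[OF F] by blast
  let ?W = "{z. \<forall>i\<in>F. 0 < c i z}"
  have "z \<in> cone_of V F" if "z \<in> ?W" for z
    unfolding cone_of_eq[OF finite_face[OF F(1)]] using c(2)[of z] that
    by (intro CollectI exI[of _ "\<lambda>i. c i z"]) auto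
  then have "?W \<subseteq> \<Union>(fan_cones \<Delta> V)"
    using F(1) by (auto simp: fan_cones_def)
  moreover have "open ?W"
    using finite_face[OF F(1)] c(1) by (rule open_linear_positive)
  moreover have "(\<Sum>i\<in>F. u i *\<^sub>R V i) \<in> ?W" using c(3) u by simp
  ultimately show ?thesis by (meson interiorI)
qed

text \<open>Near the given point, a \<open>z\<close> with \<open>c e z \<ge> 0\<close> lies in the
  cone of \<open>F\<close>. Any other nearby \<open>z\<close> lies in the cone of the flipped facet,
  because \<open>V p\<close> has negative coordinate \<open>d e\<close>, that is, lies across the
  ridge.\<close>

lemma ridge_interior:
  assumes F: "F \<in> \<Delta>" "card F = DIM('v)" and e: "e \<in> F" and u: "\<forall>i\<in>F-{e}. 0 < u i"
  shows "(\<Sum>i\<in>F-{e}. u i *\<^sub>R V i) \<in> interior (\<Union>(fan_cones \<Delta> V))"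
proof -
  obtain c where c: "\<And>i. linear (c i)" "\<And>x. x = (\<Sum>i\<in>F. c i x *\<^sub>R V i)"
      "\<And>u i. i \<in> F \<Longrightarrow> c i (\<Sum>i\<in>F. u i *\<^sub>R V i) = u i"
    using facet_coordinates[OF F] by blast
  obtain p where p: "p \<notin> F" and G: "insert p (F - {e}) \<in> \<Delta>"
    using flip[OF F e] by blast
  have fin: "finite F" using finite_face F by blast
  define d where "d i = c i (V p)" for i
  have Vp: "V p = d e *\<^sub>R V e + (\<Sum>i\<in>F-{e}. d i *\<^sub>R V i)"
    using c(2)[of "V p"] fin e by (simp add: d_def sum.remove)
  \<comment> \<open>If \<open>d e \<ge> 0\<close>, adding a large multiple of all ridge generators
    to the expansion of \<open>V p\<close> gives a point with two representations, one with
    \<open>p\<close> in its support and supported on the flipped facet, the other supported on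
    \<open>F\<close>.\<close>
  have de: "d e < 0"
  proof (rule ccontr)
    assume neg: "\<not> d e < 0"
    \<comment> \<open>Large enough to make every \<open>d i + t\<close> nonnegative.\<close>
    define t where "t = (\<Sum>i\<in>F. \<bar>d i\<bar>)"
    have t: "- d i \<le> t" "0 \<le> t" if "i \<in> F" for i
      using member_le_sum[of i F "\<lambda>i. \<bar>d i\<bar>"] fin that
      by (auto simp: t_def sum_nonneg intro: order_trans[OF abs_ge_minus_self])
    let ?f = "\<lambda>i. if i = p then 1 else if i \<in> F - {e} then t else 0"
    let ?g = "\<lambda>i. if i = e then d e else if i \<in> F - {e} then d i + t else 0"
    have sf: "{i. ?f i \<noteq> 0} \<subseteq> insert p (F - {e})" and sg: "{i. ?g i \<noteq> 0} \<subseteq> F"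
      using e by auto
    have "(\<Sum>i\<in>N. ?f i *\<^sub>R V i) = (\<Sum>i\<in>insert p (F - {e}). ?f i *\<^sub>R V i)"
      by (rule sum_face[OF G sf])
    also have "\<dots> = V p + (\<Sum>i\<in>F-{e}. ?f i *\<^sub>R V i)"
      using p fin by simp
    also have "(\<Sum>i\<in>F-{e}. ?f i *\<^sub>R V i) = (\<Sum>i\<in>F-{e}. t *\<^sub>R V i)"
      using p by (intro sum.cong) auto
    also have "V p + \<dots> = d e *\<^sub>R V e + (\<Sum>i\<in>F-{e}. (d i + t) *\<^sub>R V i)"
      unfolding Vp by (simp add: scaleR_add_left sum.distrib)
    also have "(\<Sum>i\<in>F-{e}. (d i + t) *\<^sub>R V i) = (\<Sum>i\<in>F-{e}. ?g i *\<^sub>R V i)"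
      by (intro sum.cong) auto
    also have "d e *\<^sub>R V e + \<dots> = (\<Sum>i\<in>F. ?g i *\<^sub>R V i)"
      using fin e by (subst sum.remove[of F e]) simp_all
    also have "\<dots> = (\<Sum>i\<in>N. ?g i *\<^sub>R V i)"
      by (rule sum_face[OF F(1) sg, symmetric])
    finally have "?f = ?g"
    proof (intro unique)
      show "\<forall>i. 0 \<le> ?f i" "\<forall>i. 0 \<le> ?g i"
        using t[OF e] t neg by (auto simp: algebra_simps add_increasing2 minus_le_iff) (smt (verit) t)
      show "{i. ?f i \<noteq> 0} \<in> \<Delta>" by (rule subface[OF G sf])
      show "{i. ?g i \<noteq> 0} \<in> \<Delta>" by (rule subface[OF F(1) sg])
    qed
    then have "?f p = ?g p" by (rule fun_cong)
    moreover have "p \<noteq> e" using p e by blast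
    ultimately show False using p by simp
  qed
  \<comment> \<open>Eliminating \<open>V e\<close> by means of \<open>Vp\<close> gives the
    coordinates in the flipped facet: \<open>h i z\<close> on the ridge and
    \<open>c e z / d e\<close> at \<open>p\<close>.\<close>
  define h where "h i z = c i z - (c e z / d e) * d i" for i z
  let ?W = "{z. \<forall>i\<in>F-{e}. 0 < c i z} \<inter> {z. \<forall>i\<in>F-{e}. 0 < h i z}"
  have linh: "linear (h i)" for i
    unfolding h_def using c(1)
    by (intro linearI) (simp_all add: linear_add linear_scale algebra_simps add_divide_distrib)
  have "z \<in> \<Union>(fan_cones \<Delta> V)" if z: "z \<in> ?W" for z
  proof (cases "0 \<le> c e z")
    case True
    then have "z \<in> cone_of V F"
      unfolding cone_of_eq[OF fin] using c(2)[of z] z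
      by (intro CollectI exI[of _ "\<lambda>i. c i z"]) (auto intro: less_imp_le)
    then show ?thesis using F by (auto simp: fan_cones_def)
  next
    case False
    have sub: "c i z = h i z + (c e z / d e) * d i" for i by (simp add: h_def)
    have "z = c e z *\<^sub>R V e + (\<Sum>i\<in>F-{e}. c i z *\<^sub>R V i)"
      using c(2)[of z] fin e by (simp add: sum.remove)
    also have "(\<Sum>i\<in>F-{e}. c i z *\<^sub>R V i)
        = (\<Sum>i\<in>F-{e}. h i z *\<^sub>R V i) + (c e z / d e) *\<^sub>R (\<Sum>i\<in>F-{e}. d i *\<^sub>R V i)"
      by (subst sub) (simp add: scaleR_add_left sum.distrib scaleR_sum_right)
    also have "(\<Sum>i\<in>F-{e}. d i *\<^sub>R V i) = V p - d e *\<^sub>R V e" using Vp by simp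
    finally have zeq: "z = (c e z / d e) *\<^sub>R V p + (\<Sum>i\<in>F-{e}. h i z *\<^sub>R V i)"
      using de by (simp add: scaleR_diff_right add.commute)
    let ?u = "\<lambda>i. if i = p then c e z / d e else h i z"
    have "(\<Sum>i\<in>insert p (F-{e}). ?u i *\<^sub>R V i) = (c e z / d e) *\<^sub>R V p + (\<Sum>i\<in>F-{e}. h i z *\<^sub>R V i)"
      using p fin by (simp, intro sum.cong) auto
    with zeq have "z = (\<Sum>i\<in>insert p (F-{e}). ?u i *\<^sub>R V i)" by simp
    moreover have "\<forall>i\<in>insert p (F-{e}). 0 \<le> ?u i"
      using z False de by (auto intro: less_imp_le divide_nonpos_neg)
    ultimately have "z \<in> cone_of V (insert p (F-{e}))"
      unfolding cone_of_eq[OF finite_face[OF G]] by (intro CollectI exI[of _ ?u] conjI)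
    then show ?thesis using G by (auto simp: fan_cones_def)
  qed
  then have "?W \<subseteq> \<Union>(fan_cones \<Delta> V)" by blast
  moreover have "open ?W"
    using fin c(1) linh by (intro open_Int open_linear_positive) auto
  moreover have "(\<Sum>i\<in>F-{e}. u i *\<^sub>R V i) \<in> ?W"
  proof -
    let ?v = "\<lambda>i. if i = e then 0 else u i"
    have eq: "(\<Sum>i\<in>F-{e}. u i *\<^sub>R V i) = (\<Sum>i\<in>F. ?v i *\<^sub>R V i)"
      using fin by (intro sum.mono_neutral_cong_left) auto
    have "c i (\<Sum>i\<in>F-{e}. u i *\<^sub>R V i) = ?v i" if "i \<in> F" for i
      unfolding eq by (rule c(3)[OF that])
    then show ?thesis using u e by (simp add: h_def)
  qed
  ultimately show ?thesis by (meson interiorI)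
qed

lemma closed_support: "closed (\<Union>(fan_cones \<Delta> V))"
  using finite_complex finite_face
  by (auto simp: fan_cones_def cone_of_def intro!: closed_Union closed_convex_cone_hull)

lemma support_eq_UNIV: "\<Union>(fan_cones \<Delta> V) = UNIV"
proof (rule ccontr)
  let ?U = "\<Union>(fan_cones \<Delta> V)"
  assume "?U \<noteq> UNIV"
  then obtain v where v: "v \<notin> ?U" by blast
  obtain F where F: "F \<in> \<Delta>" "card F = DIM('v)"
    using nonempty pure by blast
  define L where "L = (\<Union>I\<in>{I\<in>\<Delta>. card I + 2 \<le> DIM('v)}. span (insert v (V ` I)))"
  have "negligible (span (insert v (V ` I)))" if "I \<in> \<Delta>" "card I + 2 \<le> DIM('v)" for I
  proof (rule negligible_lowdim)
    have "dim (span (insert v (V ` I))) \<le> card (insert v (V ` I))"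
      using finite_face[OF that(1)] by (simp add: dim_le_card' del: card_insert_if)
    also have "\<dots> \<le> Suc (card I)"
      using card_image_le[OF finite_face[OF that(1)], of V] card_insert_le_m1
      by (metis Suc_le_mono card_insert_le_m1 card_insert_if finite_imageI finite_face[OF that(1)] le_SucI)
    finally show "dim (span (insert v (V ` I))) < DIM('v)" using that by simp
  qed
  then have "negligible L"
    unfolding L_def using finite_complex by (intro negligible_Union) auto
  moreover have "(\<Sum>i\<in>F. 1 *\<^sub>R V i) \<in> interior ?U"
    using facet_interior[OF F, of "\<lambda>_. 1"] by simp
  then have "\<not> negligible (interior ?U)"
    using open_not_negligible[of "interior ?U"] by blast
  ultimately obtain w where w: "w \<in> interior ?U" "w \<notin> L"
    using negligible_subset by blast
  define x where "x t = (1 - t) *\<^sub>R w + t *\<^sub>R v" for t :: real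
  have contx: "continuous_on S x" for S
    unfolding x_def by (intro continuous_intros)
  \<comment> \<open>The support of a representation of \<open>x t\<close> misses at most one vertex
    of a facet containing it, so one of the two interior lemmas applies.\<close>
  have int: "x t \<in> interior ?U" if "t < 1" "x t \<in> ?U" for t
  proof -
    from that(2) obtain J where J: "J \<in> \<Delta>" "x t \<in> cone_of V J" by (auto simp: fan_cones_def)
    then obtain f where f: "\<forall>i. 0 \<le> f i" "{i. f i \<noteq> 0} \<subseteq> J" "x t = (\<Sum>i\<in>N. f i *\<^sub>R V i)"
      unfolding mem_cone_iff[OF J(1)] by blast
    define I where "I = {i. f i \<noteq> 0}"
    have I: "I \<in> \<Delta>" using f(2) J(1) subface by (simp add: I_def)
    have fpos: "0 < f i" if "i \<in> I" for i
      using f(1) that by (simp add: I_def order_less_le)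
    have xt: "x t = (\<Sum>i\<in>I. f i *\<^sub>R V i)"
      unfolding f(3) by (rule sum_face[OF I]) (simp add: I_def)
    have "DIM('v) \<le> card I + 1"
    proof (rule ccontr)
      assume "\<not> DIM('v) \<le> card I + 1"
      then have "w \<notin> span (insert v (V ` I))"
        using w(2) I by (auto simp: L_def)
      moreover have "x t \<in> span (insert v (V ` I))"
        unfolding xt by (intro span_sum span_scale span_base) auto
      then have "(1 / (1 - t)) *\<^sub>R (x t - t *\<^sub>R v) \<in> span (insert v (V ` I))"
        by (intro span_scale span_diff) (simp_all add: span_base)
      moreover have "(1 / (1 - t)) *\<^sub>R (x t - t *\<^sub>R v) = w"
        using \<open>t < 1\<close> by (simp add: x_def)
      ultimately show False by simp
    qed
    obtain G where G: "G \<in> \<Delta>" "I \<subseteq> G" "card G = DIM('v)" using pure[OF I] by blast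
    have "finite G" using finite_face G by blast
    then have cI: "card (G - I) = card G - card I" using G(2)
      by (meson card_Diff_subset finite_subset)
    show ?thesis
    proof (cases "G = I")
      case True
      then show ?thesis unfolding xt using facet_interior[of I f] G fpos by simp
    next
      case False
      then have "card (G - I) \<noteq> 0" using G(2) \<open>finite G\<close> by auto
      then have "card (G - I) = 1" using cI \<open>DIM('v) \<le> card I + 1\<close> G(3) by linarith
      then obtain e where "G - I = {e}" by (auto simp: card_1_singleton_iff)
      then have "e \<in> G" "I = G - {e}" using G(2) by auto
      then show ?thesis unfolding xt using ridge_interior[of G e f] G fpos by simp
    qed
  qed
  \<comment> \<open>The parameters of points in the support are clopen in the half-open interval:
    open by \<open>int\<close>, closed by \<open>closed_support\<close>.\<close>
  let ?S = "{t \<in> {0..<1}. x t \<in> ?U}"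
  have "?S = {0..<1} \<inter> x -` interior ?U"
    using int interior_subset[of ?U] by auto
  then have "openin (top_of_set {0..<1}) ?S"
    using continuous_openin_preimage_gen[OF contx open_interior] by simp
  moreover have "?S = {0..<1} \<inter> x -` ?U" by auto
  then have "closedin (top_of_set {0..<1}) ?S"
    using continuous_closedin_preimage[OF contx closed_support] by simp
  moreover have "connected {0..<(1::real)}" by simp
  moreover have "0 \<in> ?S"
    using w(1) interior_subset[of ?U] by (auto simp: x_def)
  ultimately have "?S = {0..<1}"
    unfolding connected_clopen by blast
  \<comment> \<open>The endpoint lies outside the range of \<open>int\<close>; it is reached by
    closedness alone.\<close>
  then have "{0..<1} \<subseteq> x -` ?U" by blast
  moreover have "closed (x -` ?U)"
    using closed_support contx by (rule closed_vimage)
  ultimately have "closure {0..<1} \<subseteq> x -` ?U" by (rule closure_minimal)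
  moreover have "1 \<in> closure {0..<(1::real)}" by simp
  ultimately have "x 1 \<in> ?U" by blast
  with v show False by (simp add: x_def)
qed

theorem complete_fan: "complete_fan_realizing \<Delta> V"
  unfolding complete_fan_realizing_def
  using inj_on_face independent_face cone_Int support_eq_UNIV by blast

lemma poset_isomorphic_fan_cones: "poset_isomorphic (fan_cones \<Delta> V) \<Delta>"
proof -
  have inj: "inj_on (cone_of V) \<Delta>"
    by (rule inj_onI) (metis cone_subset_iff subset_antisym order_refl)
  have "bij_betw (inv_into \<Delta> (cone_of V)) (fan_cones \<Delta> V) \<Delta>"
    unfolding fan_cones_def by (rule bij_betw_inv_into) (simp add: bij_betw_def inj)
  moreover have "C \<subseteq> D \<longleftrightarrow> inv_into \<Delta> (cone_of V) C \<subseteq> inv_into \<Delta> (cone_of V) D"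
    if "C \<in> fan_cones \<Delta> V" "D \<in> fan_cones \<Delta> V" for C D
  proof -
    from that obtain I J where "I \<in> \<Delta>" "C = cone_of V I" "J \<in> \<Delta>" "D = cone_of V J"
      by (auto simp: fan_cones_def)
    then show ?thesis using inj by (simp add: cone_subset_iff)
  qed
  ultimately show ?thesis unfolding poset_isomorphic_def by blast
qed

end

section \<open>Crossings in the (2m)-gon\<close>

text \<open>Modulo \<open>2 * m\<close>, the exceptional value \<open>(m + 1, 2 * m)\<close> is \<open>(i - 1, i + m)\<close> for \<open>i = 1\<close> as well.\<close>

definition diagonal1 :: "nat \<Rightarrow> nat \<Rightarrow> nat \<times> nat" where
  "diagonal1 m i = (if i = 1 then (m + 1, 2 * m) else (i - 1, i + m))"

definition diagonal2 :: "nat \<Rightarrow> nat \<Rightarrow> nat \<times> nat" where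
  "diagonal2 m i = (i, i + m)"

definition diagonal3 :: "nat \<Rightarrow> nat \<Rightarrow> nat \<times> nat" where
  "diagonal3 m i = (i, i + m - 1)"

lemmas diagonal_defs = diagonal1_def diagonal2_def diagonal3_def

lemma crossing_sym: "crossing d e \<longleftrightarrow> crossing e d"
  by (simp add: crossing_def disj_commute)

lemma not_crossing_self: "\<not> crossing d d"
  by (simp add: crossing_def)

lemma diagonal_eq_iff:
  assumes "m \<ge> 3" "i \<in> {1..m}" "j \<in> {1..m}"
  shows "diagonal1 m i = diagonal1 m j \<longleftrightarrow> i = j" "diagonal2 m i = diagonal2 m j \<longleftrightarrow> i = j"
    "diagonal3 m i = diagonal3 m j \<longleftrightarrow> i = j" "diagonal1 m i \<noteq> diagonal2 m j"
    "diagonal1 m i \<noteq> diagonal3 m j" "diagonal2 m i \<noteq> diagonal3 m j"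
    "diagonal2 m i \<noteq> diagonal1 m j" "diagonal3 m i \<noteq> diagonal1 m j" "diagonal3 m i \<noteq> diagonal2 m j"
  using assms by (auto simp: diagonal_defs)

text \<open>Diagonals of different indices can fail to cross only for neighbouring indices, with
  \<open>m\<close> and 1 counted as neighbours; the side conditions exclude these pairs where
  necessary.\<close>

lemma crossing_diagonals:
  assumes "m \<ge> 3" "1 \<le> i" "i < j" "j \<le> m"
  shows "1 < i \<or> j < m \<Longrightarrow> crossing (diagonal1 m i) (diagonal1 m j)"
    and "crossing (diagonal2 m i) (diagonal2 m j)"
    and "1 < i \<or> j < m \<Longrightarrow> crossing (diagonal3 m i) (diagonal3 m j)"
    and "1 < i \<or> j < m \<Longrightarrow> crossing (diagonal1 m i) (diagonal2 m j)"
    and "1 < i \<or> j < m \<Longrightarrow> crossing (diagonal3 m i) (diagonal2 m j)"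
    and "Suc i < j \<Longrightarrow> crossing (diagonal1 m i) (diagonal3 m j)"
    and "Suc i < j \<Longrightarrow> crossing (diagonal2 m i) (diagonal1 m j)"
    and "Suc i < j \<Longrightarrow> crossing (diagonal2 m i) (diagonal3 m j)"
    and "Suc i < j \<Longrightarrow> crossing (diagonal3 m i) (diagonal1 m j)"
  using assms unfolding crossing_def diagonal_defs
  by (cases "i = 1"; simp; linarith)+

lemma not_crossing_same_index:
  assumes "m \<ge> 3" "i \<in> {1..m}"
  shows "\<not> crossing (diagonal1 m i) (diagonal2 m i)" "\<not> crossing (diagonal1 m i) (diagonal3 m i)"
    "\<not> crossing (diagonal2 m i) (diagonal3 m i)"
  using assms by (auto simp: crossing_def diagonal_defs)

lemma not_crossing_consecutive:
  assumes "m \<ge> 3" "1 \<le> i" "Suc i \<le> m"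
  shows "\<not> crossing (diagonal1 m (Suc i)) (diagonal2 m i)" "\<not> crossing (diagonal1 m (Suc i)) (diagonal3 m i)"
    "\<not> crossing (diagonal3 m (Suc i)) (diagonal2 m i)" "\<not> crossing (diagonal3 m (Suc i)) (diagonal1 m i)"
  using assms by (auto simp: crossing_def diagonal_defs)

text \<open>Read modulo \<open>2 * m\<close>, the formulas at index i + m return the diagonals of
  index i with types 1 and 3 exchanged. So these are the consecutive pairs from \<open>m\<close> to
  \<open>m + 1\<close>, that is, to 1 with types exchanged.\<close>

lemma not_crossing_extreme:
  assumes "m \<ge> 3"
  shows "\<not> crossing (diagonal1 m 1) (diagonal2 m m)" "\<not> crossing (diagonal1 m 1) (diagonal1 m m)"
    "\<not> crossing (diagonal3 m 1) (diagonal2 m m)" "\<not> crossing (diagonal3 m 1) (diagonal3 m m)"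
  using assms by (auto simp: crossing_def diagonal_defs)

text \<open>The descent from \<open>l\<close> to \<open>i\<close> must not pass through the gap
  \<open>h\<close>; \<open>h < i \<or> l \<le> h\<close> says that none of its steps ends
  there.\<close>

lemma propagate_down:
  fixes T :: "nat set"
  assumes step: "\<And>i. \<lbrakk>1 \<le> i; Suc i \<le> m; Suc i \<in> T; i \<noteq> h\<rbrakk> \<Longrightarrow> i \<in> T"
    and "l \<in> T" "1 \<le> i" "i \<le> l" "l \<le> m" "h < i \<or> l \<le> h"
  shows "i \<in> T"
  using \<open>i \<le> l\<close> \<open>1 \<le> i\<close> \<open>h < i \<or> l \<le> h\<close>
proof (induction rule: inc_induct)
  case (step n)
  then have "Suc n \<in> T" by auto
  moreover have "n \<noteq> h" using step by auto
  ultimately show ?case using assms(1)[of n] step \<open>l \<le> m\<close> by auto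
qed (rule \<open>l \<in> T\<close>)

text \<open>The index sets \<open>T1\<close>, \<open>T2\<close>, \<open>T3\<close> of the diagonals of an \<open>(m - 1)\<close>-crossing cover all indices
  except one index \<open>h\<close>, and membership in \<open>T1\<close> or \<open>T3\<close> propagates downwards up to the gap \<open>h\<close>.\<close>

lemma crossing_avoids_pattern:
  assumes m: "m \<ge> 3"
    and T: "T \<subseteq> diagonal1 m ` Y1 \<union> diagonal2 m ` Y2 \<union> diagonal3 m ` Y3"
    and Y: "Y1 \<subseteq> {1..m}" "Y2 \<subseteq> {1..m}" "Y3 \<subseteq> {1..m}"
    and card: "card T = m - 1" and cross: "pairwise crossing T"
  shows "\<not> w0_pattern ({1..m} - Y1) ({1..m} - Y2) ({1..m} - Y3)"
proof
  assume pat: "w0_pattern ({1..m} - Y1) ({1..m} - Y2) ({1..m} - Y3)"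
  define T1 T2 T3 where "T1 = {i\<in>{1..m}. diagonal1 m i \<in> T}"
    and "T2 = {i\<in>{1..m}. diagonal2 m i \<in> T}" and "T3 = {i\<in>{1..m}. diagonal3 m i \<in> T}"
  have cr: "crossing x y" if "x \<in> T" "y \<in> T" "x \<noteq> y" for x y
    using cross that by (auto simp: pairwise_def)
  have disj: "i \<notin> T1 \<or> i \<notin> T2" "i \<notin> T1 \<or> i \<notin> T3" "i \<notin> T2 \<or> i \<notin> T3" for i
    using cr[of "diagonal1 m i" "diagonal2 m i"] cr[of "diagonal1 m i" "diagonal3 m i"]
      cr[of "diagonal2 m i" "diagonal3 m i"] not_crossing_same_index[OF m, of i]
      diagonal_eq_iff[OF m, of i i]
    unfolding T1_def T2_def T3_def by blast+
  have TY: "T1 \<subseteq> Y1" "T2 \<subseteq> Y2" "T3 \<subseteq> Y3"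
  proof -
    have "i \<in> Y1" if "i \<in> {1..m}" "diagonal1 m i \<in> T" for i
      using that T Y diagonal_eq_iff[OF m that(1)] by (smt (verit) UnE imageE subsetD)
    moreover have "i \<in> Y2" if "i \<in> {1..m}" "diagonal2 m i \<in> T" for i
      using that T Y diagonal_eq_iff[OF m that(1)] by (smt (verit) UnE imageE subsetD)
    moreover have "i \<in> Y3" if "i \<in> {1..m}" "diagonal3 m i \<in> T" for i
      using that T Y diagonal_eq_iff[OF m that(1)] by (smt (verit) UnE imageE subsetD)
    ultimately show "T1 \<subseteq> Y1" "T2 \<subseteq> Y2" "T3 \<subseteq> Y3" by (auto simp: T1_def T2_def T3_def)
  qed
  \<comment> \<open>Diagonals of the same index do not cross, so each index contributes at most one
    member of \<open>T\<close>. As \<open>T\<close> has \<open>m - 1\<close> members, at most one of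
    the \<open>m\<close> indices is left out.\<close>
  obtain h where cover: "\<And>i. \<lbrakk>i \<in> {1..m}; i \<noteq> h\<rbrakk> \<Longrightarrow> i \<in> T1 \<or> i \<in> T2 \<or> i \<in> T3"
  proof -
    let ?B = "T1 \<union> T2 \<union> T3"
    have B: "?B \<subseteq> {1..m}" by (auto simp: T1_def T2_def T3_def)
    then have finB: "finite ?B" by (rule finite_subset) simp
    let ?g = "\<lambda>i. if i \<in> T1 then diagonal1 m i else if i \<in> T2 then diagonal2 m i else diagonal3 m i"
    have "T \<subseteq> ?g ` ?B"
    proof
      fix t assume t: "t \<in> T"
      then consider i where "i \<in> T1" "t = diagonal1 m i" | i where "i \<in> T2" "t = diagonal2 m i"
        | i where "i \<in> T3" "t = diagonal3 m i"
        using T Y unfolding T1_def T2_def T3_def by blast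
      then show "t \<in> ?g ` ?B"
      proof cases
        case 1
        then show ?thesis by force
      next
        case 2
        then show ?thesis using disj[of i] by force
      next
        case 3
        then show ?thesis using disj[of i] by force
      qed
    qed
    then have "card T \<le> card (?g ` ?B)" using finB by (intro card_mono) auto
    also have "\<dots> \<le> card ?B" by (rule card_image_le[OF finB])
    finally have "card ({1..m} - ?B) \<le> 1"
      unfolding card_Diff_subset[OF finB B] using card by simp
    then have "\<exists>h. {1..m} - ?B \<subseteq> {h}"
      by (metis card_le_Suc0_iff_eq One_nat_def finite_Diff finite_atLeastAtMost singletonI subsetI)
    then show ?thesis using that by blast
  qed
  have "i \<in> T1" if "1 \<le> i" "Suc i \<le> m" "Suc i \<in> T1" "i \<noteq> h" for i
    using cover[of i] cr[of "diagonal1 m (Suc i)" "diagonal2 m i"] cr[of "diagonal1 m (Suc i)" "diagonal3 m i"]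
      not_crossing_consecutive[OF m that(1,2)] diagonal_eq_iff[OF m, of "Suc i" i] that
    by (auto simp: T1_def T2_def T3_def)
  note down1 = propagate_down[of m T1 h, OF this]
  have "i \<in> T3" if "1 \<le> i" "Suc i \<le> m" "Suc i \<in> T3" "i \<noteq> h" for i
    using cover[of i] cr[of "diagonal3 m (Suc i)" "diagonal2 m i"] cr[of "diagonal3 m (Suc i)" "diagonal1 m i"]
      not_crossing_consecutive[OF m that(1,2)] diagonal_eq_iff[OF m, of "Suc i" i] that
    by (auto simp: T1_def T2_def T3_def)
  note down3 = propagate_down[of m T3 h, OF this]
  \<comment> \<open>Passing from index 1 back to \<open>m\<close> exchanges the types 1 and
    3.\<close>
  have wrap1: "m \<in> T3 \<or> h = m" if "1 \<in> T1"
    using cover[of m] cr[of "diagonal1 m 1" "diagonal2 m m"] cr[of "diagonal1 m 1" "diagonal1 m m"]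
      not_crossing_extreme[OF m] diagonal_eq_iff[OF m, of 1 m] that m
    by (auto simp: T1_def T2_def T3_def)
  have wrap3: "m \<in> T1 \<or> h = m" if "1 \<in> T3"
    using cover[of m] cr[of "diagonal3 m 1" "diagonal2 m m"] cr[of "diagonal3 m 1" "diagonal3 m m"]
      not_crossing_extreme[OF m] diagonal_eq_iff[OF m, of 1 m] that m
    by (auto simp: T1_def T2_def T3_def)
  let ?X1 = "{1..m} - Y1" and ?X2 = "{1..m} - Y2" and ?X3 = "{1..m} - Y3"
  obtain i1 j1 k1 i2 j2 k2 i j k l where
    p1: "i1 \<in> ?X1" "j1 \<in> ?X2" "k1 \<in> ?X3" "k1 \<le> j1" "j1 < i1" and
    p2: "i2 \<in> ?X1" "j2 \<in> ?X2" "k2 \<in> ?X3" "i2 \<le> j2" "j2 < k2" and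
    p3: "i \<in> ?X1" "j \<in> ?X2" "k \<in> ?X3" "l \<in> ?X2" "j < i" "j < k" "i \<le> l" "k \<le> l"
    by (rule w0_patternE[OF pat])
  have X: "x \<notin> T1" if "x \<in> ?X1" for x
    using that TY by blast
  have X2: "x \<notin> T2" if "x \<in> ?X2" for x
    using that TY by blast
  have X3: "x \<notin> T3" if "x \<in> ?X3" for x
    using that TY by blast
  \<comment> \<open>With type 3 at index 1, type 1 occupies everything above the gap, and the
    witness for 123 fails; type 1 at index 1 likewise refutes 321. Otherwise type 2 fills everything
    below the gap, which forces \<open>h \<le> j\<close>, and propagation from \<open>l\<close>
    reaches \<open>i\<close> or \<open>k\<close>.\<close>
  consider "1 \<in> T3" "h \<noteq> 1" | "1 \<in> T1" "h \<noteq> 1" | "1 \<notin> T1" "1 \<notin> T3" | "h = 1"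
    by blast
  then show False
  proof cases
    case 1
    have "i1 \<le> h"
      using down1[of m i1] wrap3 1 X p1 by (auto simp: not_le[symmetric])
    moreover have "j1 \<notin> T1"
      using down1[of j1 1] disj(2)[of 1] 1 p1 \<open>i1 \<le> h\<close> by auto
    ultimately have "j1 \<in> T3" using cover[of j1] X2 p1 by auto
    then have "k1 \<in> T3" using down3[of j1 k1] p1 \<open>i1 \<le> h\<close> by auto
    then show False using X3 p1 by blast
  next
    case 2
    have "k2 \<le> h"
      using down3[of m k2] wrap1 2 X3 p2 by (auto simp: not_le[symmetric])
    moreover have "j2 \<notin> T3"
      using down3[of j2 1] disj(2)[of 1] 2 p2 \<open>k2 \<le> h\<close> by auto
    ultimately have "j2 \<in> T1" using cover[of j2] X2 p2 by auto
    then have "i2 \<in> T1" using down1[of j2 i2] p2 \<open>k2 \<le> h\<close> by auto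
    then show False using X p2 by blast
  next
    case 3
    have hj: "h \<le> j"
    proof (rule ccontr)
      assume "\<not> h \<le> j"
      moreover have "j \<in> {1..m}" "j \<notin> T2" using X2 p3 by auto
      ultimately have "j \<in> T1 \<or> j \<in> T3" using cover[of j] by auto
      then show False
        using down1[of j 1] down3[of j 1] 3 \<open>\<not> h \<le> j\<close> \<open>j \<in> {1..m}\<close> by auto
    qed
    have "l \<in> T1 \<or> l \<in> T3" using cover[of l] hj p3 X2 by auto
    then show False using down1[of l i] down3[of l k] hj p3 X X3 by auto
  next
    case 4
    then have hj: "h \<le> j" using p3 by auto
    have "l \<in> T1 \<or> l \<in> T3" using cover[of l] hj p3 X2 by auto
    then show False using down1[of l i] down3[of l k] hj p3 X X3 by auto
  qed
qed

lemma exists_crossing_family: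
  assumes "h \<in> {1..m}"
    and "\<And>i. i \<in> {1..m} - {h} \<Longrightarrow> f i \<in> S"
    and cr: "\<And>i j. \<lbrakk>i \<in> {1..m} - {h}; j \<in> {1..m} - {h}; i < j\<rbrakk> \<Longrightarrow> crossing (f i) (f j)"
  shows "\<exists>T\<subseteq>S. card T = m - 1 \<and> pairwise crossing T"
proof (intro exI conjI)
  have ne: "crossing (f i) (f j)" if "i \<in> {1..m} - {h}" "j \<in> {1..m} - {h}" "i \<noteq> j" for i j
    using that cr[of i j] cr[of j i] crossing_sym[of "f i" "f j"] by (cases "i < j") simp_all
  have "inj_on f ({1..m} - {h})"
  proof (rule inj_onI, rule ccontr)
    fix i j assume "i \<in> {1..m} - {h}" "j \<in> {1..m} - {h}" "f i = f j" "i \<noteq> j"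
    then show False using ne[of i j] by (simp add: not_crossing_self)
  qed
  then show "card (f ` ({1..m} - {h})) = m - 1"
    using assms(1) by (simp add: card_image)
  show "pairwise crossing (f ` ({1..m} - {h}))"
  proof (rule pairwiseI)
    fix x y assume "x \<in> f ` ({1..m} - {h})" "y \<in> f ` ({1..m} - {h})" "x \<noteq> y"
    then obtain i j where "i \<in> {1..m} - {h}" "x = f i" "j \<in> {1..m} - {h}" "y = f j" "i \<noteq> j"
      by blast
    then show "crossing x y" using ne by simp
  qed
qed (use assms(2) in blast)

text \<open>The extreme choices i = Max X and k = Min Z decide whether a triple exists, so exactly
  the stretch between them has to miss Y.\<close>

lemma avoids_123:
  fixes m :: nat
  assumes "X \<subseteq> {1..m}" "Y \<subseteq> {1..m}" "Z \<subseteq> {1..m}" "1 \<le> m"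
    and no: "\<not> (\<exists>i\<in>X. \<exists>j\<in>Y. \<exists>k\<in>Z. k \<le> j \<and> j < i)"
  obtains h t where "1 \<le> t" "t \<le> h" "h \<le> m" "{h<..m} \<inter> X = {}" "{t..<h} \<inter> Y = {}" "{1..<t} \<inter> Z = {}"
proof -
  have fin: "finite X" "finite Z"
    using finite_subset[OF assms(1)] finite_subset[OF assms(3)] by simp_all
  \<comment> \<open>For empty \<open>X\<close> or \<open>Z\<close> the defaults make the interval
    from \<open>t\<close> to \<open>h\<close> empty; \<open>t\<close> is capped at \<open>h\<close>
    for the same reason.\<close>
  define h where "h = (if X = {} then 1 else Max X)"
  define t where "t = (if Z = {} then h else min h (Min Z))"
  have h: "h \<in> {1..m}" "{h<..m} \<inter> X = {}"
  proof -
    show "h \<in> {1..m}" using subsetD[OF assms(1) Max_in[OF fin(1)]] assms(4) by (auto simp: h_def)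
    have "x \<le> h" if "x \<in> X" for x using that fin by (auto simp: h_def)
    then show "{h<..m} \<inter> X = {}" by (meson disjoint_iff greaterThanAtMost_iff not_le)
  qed
  have "1 \<le> t" "t \<le> h"
    using h(1) subsetD[OF assms(3) Min_in[OF fin(2)]] by (auto simp: t_def)
  moreover have "t \<le> x" if "x \<in> Z" for x
    using that Min_le[OF fin(2) that] by (auto simp: t_def)
  then have "{1..<t} \<inter> Z = {}" by (meson disjoint_iff atLeastLessThan_iff not_le)
  moreover have "{t..<h} \<inter> Y = {}"
  proof (rule ccontr)
    assume "{t..<h} \<inter> Y \<noteq> {}"
    then obtain j where j: "j \<in> Y" "t \<le> j" "j < h" by auto
    then have "X \<noteq> {}" using assms(2) by (auto simp: h_def split: if_splits)
    then have "h \<in> X" using fin by (simp add: h_def)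
    have "Z \<noteq> {}" "t = Min Z" using j by (auto simp: t_def min_def split: if_splits)
    then have "t \<in> Z" using fin by simp
    then show False using no \<open>h \<in> X\<close> j by blast
  qed
  ultimately show ?thesis using that h by auto
qed

lemma crossing_if_avoids_pattern:
  assumes m: "m \<ge> 3"
    and Y: "Y1 \<subseteq> {1..m}" "Y2 \<subseteq> {1..m}" "Y3 \<subseteq> {1..m}"
    and pat: "\<not> w0_pattern ({1..m} - Y1) ({1..m} - Y2) ({1..m} - Y3)"
  shows "\<exists>T \<subseteq> diagonal1 m ` Y1 \<union> diagonal2 m ` Y2 \<union> diagonal3 m ` Y3.
    card T = m - 1 \<and> pairwise crossing T"
proof -
  let ?X1 = "{1..m} - Y1" and ?X2 = "{1..m} - Y2" and ?X3 = "{1..m} - Y3"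
  let ?S = "diagonal1 m ` Y1 \<union> diagonal2 m ` Y2 \<union> diagonal3 m ` Y3"
  have m1: "1 \<le> m" using m by simp
  have sub: "?X1 \<subseteq> {1..m}" "?X2 \<subseteq> {1..m}" "?X3 \<subseteq> {1..m}" by auto
  consider (a) "\<not> (\<exists>i\<in>?X1. \<exists>j\<in>?X2. \<exists>k\<in>?X3. k \<le> j \<and> j < i)"
    | (b) "\<not> (\<exists>i\<in>?X1. \<exists>j\<in>?X2. \<exists>k\<in>?X3. i \<le> j \<and> j < k)"
    | (c) "\<not> (\<exists>j\<in>?X2. \<exists>i\<in>?X1. \<exists>k\<in>?X3. \<exists>l\<in>?X2. j < i \<and> j < k \<and> i \<le> l \<and> k \<le> l)"
    using pat unfolding w0_pattern_def by meson
  then show ?thesis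
  proof cases
    case a
    obtain h t where ht: "1 \<le> t" "t \<le> h" "h \<le> m" "{h<..m} \<inter> ?X1 = {}" "{t..<h} \<inter> ?X2 = {}"
        "{1..<t} \<inter> ?X3 = {}"
      by (rule avoids_123[OF sub m1 a])
    \<comment> \<open>Type 3 may be followed directly by type 2, whereas the change to type 1 needs
      a skipped index in between, supplied by the gap \<open>h\<close>.\<close>
    let ?f = "\<lambda>i. if i > h then diagonal1 m i else if t \<le> i then diagonal2 m i else diagonal3 m i"
    show ?thesis
    proof (rule exists_crossing_family[of h m ?f])
      fix i assume i: "i \<in> {1..m} - {h}"
      consider "i > h" | "t \<le> i" "i < h" | "i < t" using i by force
      then show "?f i \<in> ?S" using i ht by cases auto
    next
      fix i j assume "i \<in> {1..m} - {h}" "j \<in> {1..m} - {h}" "i < j"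
      then show "crossing (?f i) (?f j)" using ht(1-3) crossing_diagonals[OF m, of i j]
          by (simp split: if_splits) linarith?
    qed (use ht in auto)
  next
    case b
    have "\<not> (\<exists>k\<in>?X3. \<exists>j\<in>?X2. \<exists>i\<in>?X1. i \<le> j \<and> j < k)" using b by blast
    then obtain h t where ht: "1 \<le> t" "t \<le> h" "h \<le> m" "{h<..m} \<inter> ?X3 = {}" "{t..<h} \<inter> ?X2 = {}"
        "{1..<t} \<inter> ?X1 = {}"
      using avoids_123[OF sub(3,2,1) m1] by metis
    let ?f = "\<lambda>i. if i > h then diagonal3 m i else if t \<le> i then diagonal2 m i else diagonal1 m i"
    show ?thesis
    proof (rule exists_crossing_family[of h m ?f])
      fix i assume i: "i \<in> {1..m} - {h}"
      consider "i > h" | "t \<le> i" "i < h" | "i < t" using i by force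
      then show "?f i \<in> ?S" using i ht by cases auto
    next
      fix i j assume "i \<in> {1..m} - {h}" "j \<in> {1..m} - {h}" "i < j"
      then show "crossing (?f i) (?f j)" using ht(1-3) crossing_diagonals[OF m, of i j]
          by (simp split: if_splits) linarith?
    qed (use ht in auto)
  next
    case c
    \<comment> \<open>If type 2 is available at every index, the default leaves out index 1 and uses
      type 2 throughout.\<close>
    define h where "h = (if ?X2 = {} then 1 else Min ?X2)"
    define l where "l = (if ?X2 = {} then 1 else Max ?X2)"
    have hl: "1 \<le> h" "h \<le> l" "l \<le> m" "{1..<h} \<inter> ?X2 = {}" "{l<..m} \<inter> ?X2 = {}"
    proof -
      have "h \<le> x \<and> x \<le> l" if x: "x \<in> ?X2" for x
      proof -
        have ne: "?X2 \<noteq> {}" using x by blast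
        have "h = Min ?X2" "l = Max ?X2" by (simp_all only: h_def l_def ne if_False)
        then show ?thesis using Min_le[OF _ x] Max_ge[OF _ x] by simp
      qed
      then show "{1..<h} \<inter> ?X2 = {}" "{l<..m} \<inter> ?X2 = {}"
        by (meson disjoint_iff atLeastLessThan_iff greaterThanAtMost_iff not_le)+
      show "1 \<le> h" "h \<le> l" "l \<le> m"
        using m Min_in[of ?X2] Max_in[of ?X2] by (auto simp: h_def l_def)
    qed
    \<comment> \<open>Otherwise members of both sets, together with \<open>h\<close> and
      \<open>l\<close> as the two 2s, would form the excluded third subword. Hence type 1 or type 3
      is available on the whole interval, with type 2 on both sides of it.\<close>
    have "{h<..l} \<inter> ?X1 = {} \<or> {h<..l} \<inter> ?X3 = {}"
    proof (rule ccontr)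
      assume "\<not> ({h<..l} \<inter> ?X1 = {} \<or> {h<..l} \<inter> ?X3 = {})"
      then obtain i k where "i \<in> {h<..l} \<inter> ?X1" "k \<in> {h<..l} \<inter> ?X3" by blast
      then have ik: "i \<in> ?X1" "k \<in> ?X3" "h < i" "h < k" "i \<le> l" "k \<le> l" by auto
      then have "?X2 \<noteq> {}" by (auto simp: h_def l_def split: if_splits)
      have "h \<in> ?X2"
        unfolding h_def if_not_P[OF \<open>?X2 \<noteq> {}\<close>] by (rule Min_in[OF _ \<open>?X2 \<noteq> {}\<close>]) simp
      moreover have "l \<in> ?X2"
        unfolding l_def if_not_P[OF \<open>?X2 \<noteq> {}\<close>] by (rule Max_in[OF _ \<open>?X2 \<noteq> {}\<close>]) simp
      ultimately show False using c ik by blast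
    qed
    then show ?thesis
    proof
      assume X1: "{h<..l} \<inter> ?X1 = {}"
      let ?f = "\<lambda>i. if h < i \<and> i \<le> l then diagonal1 m i else diagonal2 m i"
      show ?thesis
      proof (rule exists_crossing_family[of h m ?f])
        fix i assume i: "i \<in> {1..m} - {h}"
        consider "h < i" "i \<le> l" | "i < h" | "l < i" using i by force
        then show "?f i \<in> ?S" using i hl X1 by cases auto
      next
        fix i j assume "i \<in> {1..m} - {h}" "j \<in> {1..m} - {h}" "i < j"
        then show "crossing (?f i) (?f j)" using hl(1-3) crossing_diagonals[OF m, of i j]
          by (simp split: if_splits) linarith?
      qed (use hl in auto)
    next
      assume X3: "{h<..l} \<inter> ?X3 = {}"
      let ?f = "\<lambda>i. if h < i \<and> i \<le> l then diagonal3 m i else diagonal2 m i"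
      show ?thesis
      proof (rule exists_crossing_family[of h m ?f])
        fix i assume i: "i \<in> {1..m} - {h}"
        consider "h < i" "i \<le> l" | "i < h" | "l < i" using i by force
        then show "?f i \<in> ?S" using i hl X3 by cases auto
      next
        fix i j assume "i \<in> {1..m} - {h}" "j \<in> {1..m} - {h}" "i < j"
        then show "crossing (?f i) (?f j)" using hl(1-3) crossing_diagonals[OF m, of i j]
          by (simp split: if_splits) linarith?
      qed (use hl in auto)
    qed
  qed
qed

section \<open>Relevant diagonals and positions of the word\<close>

definition diagonal_at :: "nat \<Rightarrow> nat \<Rightarrow> nat \<times> nat" where
  "diagonal_at m p = (let i = m - (p - 1) div 3 in
     if (p - 1) mod 3 = 0 then diagonal2 m i else if (p - 1) mod 3 = 1 then diagonal1 m i else diagonal3 m i)"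

lemma diagonal_at_pos:
  assumes "i \<in> {1..m}"
  shows "diagonal_at m (pos1 m i) = diagonal1 m i" "diagonal_at m (pos2 m i) = diagonal2 m i"
    "diagonal_at m (pos3 m i) = diagonal3 m i"
  using assms by (simp_all add: diagonal_at_def pos_div_mod)

lemma diagonal_at_image:
  assumes "I \<subseteq> {1..3 * m}"
  shows "diagonal_at m ` I = diagonal1 m ` index_set pos1 m I \<union> diagonal2 m ` index_set pos2 m I \<union>
    diagonal3 m ` index_set pos3 m I"
proof
  show "diagonal_at m ` I \<subseteq> diagonal1 m ` index_set pos1 m I \<union> diagonal2 m ` index_set pos2 m I \<union>
    diagonal3 m ` index_set pos3 m I"
  proof
    fix d assume "d \<in> diagonal_at m ` I"
    then obtain p where p: "p \<in> I" "d = diagonal_at m p" by blast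
    then have "p \<in> {1..3 * m}" using assms by blast
    then show "d \<in> diagonal1 m ` index_set pos1 m I \<union> diagonal2 m ` index_set pos2 m I \<union>
      diagonal3 m ` index_set pos3 m I"
      using p by (cases p m rule: pos_exhaust) (auto simp: index_set_def diagonal_at_pos)
  qed
  show "diagonal1 m ` index_set pos1 m I \<union> diagonal2 m ` index_set pos2 m I \<union>
    diagonal3 m ` index_set pos3 m I \<subseteq> diagonal_at m ` I"
    by (auto simp: index_set_def diagonal_at_pos[symmetric])
qed

lemma inj_on_diagonal_at:
  assumes "m \<ge> 3" shows "inj_on (diagonal_at m) {1..3 * m}"
proof (rule inj_onI)
  fix p q assume *: "p \<in> {1..3 * m}" "q \<in> {1..3 * m}" "diagonal_at m p = diagonal_at m q"
  show "p = q"
    by (rule pos_exhaust[OF *(1)]; rule pos_exhaust[OF *(2)])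
      (use *(3) diagonal_eq_iff[OF assms] in \<open>simp_all add: diagonal_at_pos\<close>)
qed

text \<open>The two sides of a diagonal have 2m - 2 vertices in total and each needs m - 2, which
  leaves j - i in {m - 1, m, m + 1}.\<close>

lemma mem_relevant_diagonals_iff:
  assumes "m \<ge> 3"
  shows "(i, j) \<in> relevant_diagonals (2 * m) (m - 2) \<longleftrightarrow>
    1 \<le> i \<and> j \<le> 2 * m \<and> i + m \<le> j + 1 \<and> j \<le> i + m + 1"
proof -
  have *: "card {v \<in> {1..2 * m}. i < v \<and> v < j} = j - i - 1"
    "card {v \<in> {1..2 * m}. v < i \<or> j < v} = (i - 1) + (2 * m - j)"
    if "1 \<le> i" "i < j" "j \<le> 2 * m"
  proof -
    have "{v \<in> {1..2 * m}. i < v \<and> v < j} = {i<..<j}" using that by auto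
    then show "card {v \<in> {1..2 * m}. i < v \<and> v < j} = j - i - 1" by simp
    have "{v \<in> {1..2 * m}. v < i \<or> j < v} = {1..<i} \<union> {j<..2 * m}" using that by auto
    moreover have "card ({1..<i} \<union> {j<..2 * m}) = card {1..<i} + card {j<..2 * m}"
      using that by (intro card_Un_disjoint) auto
    ultimately show "card {v \<in> {1..2 * m}. v < i \<or> j < v} = (i - 1) + (2 * m - j)" by simp
  qed
  show ?thesis
  proof
    assume "(i, j) \<in> relevant_diagonals (2 * m) (m - 2)"
    then have "1 \<le> i" "i + 2 \<le> j" "j \<le> 2 * m" "m - 2 \<le> card {v \<in> {1..2 * m}. i < v \<and> v < j}"
      "m - 2 \<le> card {v \<in> {1..2 * m}. v < i \<or> j < v}"
      by (auto simp: relevant_diagonals_def diagonals_def)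
    with *[OF \<open>1 \<le> i\<close> _ \<open>j \<le> 2 * m\<close>]
    show "1 \<le> i \<and> j \<le> 2 * m \<and> i + m \<le> j + 1 \<and> j \<le> i + m + 1"
      using assms by auto
  next
    assume A: "1 \<le> i \<and> j \<le> 2 * m \<and> i + m \<le> j + 1 \<and> j \<le> i + m + 1"
    then have "i < j" using assms by auto
    with A * have "m - 2 \<le> card {v \<in> {1..2 * m}. i < v \<and> v < j}"
      "m - 2 \<le> card {v \<in> {1..2 * m}. v < i \<or> j < v}"
      by auto
    moreover have "(i, j) \<in> diagonals (2 * m)"
      using A assms by (auto simp: diagonals_def)
    ultimately show "(i, j) \<in> relevant_diagonals (2 * m) (m - 2)"
      by (simp add: relevant_diagonals_def)
  qed
qed

lemma relevant_diagonals_eq: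
  assumes m: "m \<ge> 3"
  shows "relevant_diagonals (2 * m) (m - 2) = diagonal_at m ` {1..3 * m}"
proof -
  have I: "index_set pos m {1..3 * m} = {1..m}" if "pos = pos1 \<or> pos = pos2 \<or> pos = pos3" for pos
    using that pos_in_range by (auto simp: index_set_def)
  have "d \<in> relevant_diagonals (2 * m) (m - 2) \<longleftrightarrow>
      d \<in> diagonal1 m ` {1..m} \<union> diagonal2 m ` {1..m} \<union> diagonal3 m ` {1..m}" for d
  proof (cases d)
    case (Pair i j)
    show ?thesis
    proof
      assume "d \<in> relevant_diagonals (2 * m) (m - 2)"
      then have A: "1 \<le> i" "j \<le> 2 * m" "i + m \<le> j + 1" "j \<le> i + m + 1"
        using mem_relevant_diagonals_iff[OF m] Pair by auto
      then consider "j = i + m" | "j = i + m + 1" | "j + 1 = i + m" by linarith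
      then show "d \<in> diagonal1 m ` {1..m} \<union> diagonal2 m ` {1..m} \<union> diagonal3 m ` {1..m}"
      proof cases
        case 1
        then have "d = diagonal2 m i" "i \<in> {1..m}" using A Pair by (auto simp: diagonal2_def)
        then show ?thesis by blast
      next
        case 2
        then have "d = diagonal1 m (i + 1)" "i + 1 \<in> {1..m}" using A Pair by (auto simp: diagonal1_def)
        then show ?thesis by blast
      next
        case 3
        \<comment> \<open>\<open>(m + 1, 2 * m)\<close> is the only diagonal with j - i = m - 1 that
          starts beyond \<open>m\<close>; it is the exceptional value of
          \<open>diagonal1\<close>.\<close>
        show ?thesis
        proof (cases "i = m + 1")
          case True
          then have "d = diagonal1 m 1" "1 \<in> {1..m}" using 3 A Pair m by (auto simp: diagonal1_def)
          then show ?thesis by blast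
        next
          case False
          then have "d = diagonal3 m i" "i \<in> {1..m}" using 3 A Pair by (auto simp: diagonal3_def)
          then show ?thesis by blast
        qed
      qed
    next
      assume "d \<in> diagonal1 m ` {1..m} \<union> diagonal2 m ` {1..m} \<union> diagonal3 m ` {1..m}"
      then show "d \<in> relevant_diagonals (2 * m) (m - 2)"
        using m Pair by (auto simp: mem_relevant_diagonals_iff diagonal_defs split: if_splits)
    qed
  qed
  then have "relevant_diagonals (2 * m) (m - 2) =
      diagonal1 m ` {1..m} \<union> diagonal2 m ` {1..m} \<union> diagonal3 m ` {1..m}"
    by (rule set_eqI)
  then show ?thesis
    by (simp only: diagonal_at_image[OF subset_refl] I simp_thms)
qed

text \<open>The letters 2, 1, 3 of block \<open>i\<close> carry the three diagonals of index
  \<open>i\<close>. Both sides thus reduce to the same pattern on the index sets of the complement,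
  as k + 1 = m - 1.\<close>

lemma subword_complex_c213_iff_multi_associahedron:
  assumes m: "m \<ge> 3" and I: "I \<subseteq> {1..3 * m}"
  shows "I \<in> subword_complex (c213_power m) \<longleftrightarrow> diagonal_at m ` I \<in> multi_associahedron (2 * m) (m - 2)"
proof -
  have Y: "index_set pos m I \<subseteq> {1..m}" for pos by (auto simp: index_set_def)
  have "m - 2 + 1 = m - 1" using m by simp
  then have "diagonal_at m ` I \<in> multi_associahedron (2 * m) (m - 2) \<longleftrightarrow>
      \<not> (\<exists>T \<subseteq> diagonal_at m ` I. card T = m - 1 \<and> pairwise crossing T)"
    using I by (auto simp: multi_associahedron_def relevant_diagonals_eq[OF m])
  also have "\<dots> \<longleftrightarrow> w0_pattern ({1..m} - index_set pos1 m I) ({1..m} - index_set pos2 m I)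
      ({1..m} - index_set pos3 m I)"
    (is "_ \<longleftrightarrow> ?P")
  proof (cases ?P)
    case True
    then show ?thesis
      unfolding diagonal_at_image[OF I] using crossing_avoids_pattern[OF m _ Y Y Y] by metis
  next
    case False
    then show ?thesis
      unfolding diagonal_at_image[OF I] using crossing_if_avoids_pattern[OF m Y Y Y False] by simp
  qed
  finally show ?thesis using I by (simp add: subword_complex_c213_iff)
qed

lemma poset_isomorphic_trans:
  assumes "poset_isomorphic \<A> \<B>" "poset_isomorphic \<B> \<C>"
  shows "poset_isomorphic \<A> \<C>"
proof -
  obtain f where f: "bij_betw f \<A> \<B>" "\<forall>C\<in>\<A>. \<forall>D\<in>\<A>. C \<subseteq> D \<longleftrightarrow> f C \<subseteq> f D"
    using assms(1) unfolding poset_isomorphic_def by (elim exE conjE)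
  obtain g where g: "bij_betw g \<B> \<C>" "\<forall>C\<in>\<B>. \<forall>D\<in>\<B>. C \<subseteq> D \<longleftrightarrow> g C \<subseteq> g D"
    using assms(2) unfolding poset_isomorphic_def by (elim exE conjE)
  show ?thesis
    unfolding poset_isomorphic_def
  proof (intro exI[of _ "g \<circ> f"] conjI ballI)
    show "bij_betw (g \<circ> f) \<A> \<C>" using f(1) g(1) by (rule bij_betw_trans)
    fix C D assume CD: "C \<in> \<A>" "D \<in> \<A>"
    then have "f C \<in> \<B>" "f D \<in> \<B>" using bij_betwE[OF f(1)] by auto
    with f(2) g(2) CD show "C \<subseteq> D \<longleftrightarrow> (g \<circ> f) C \<subseteq> (g \<circ> f) D" by simp
  qed
qed

lemma poset_isomorphic_multi_associahedron:
  assumes m: "m \<ge> 3"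
  shows "poset_isomorphic (subword_complex (c213_power m)) (multi_associahedron (2 * m) (m - 2))"
proof -
  let ?SC = "subword_complex (c213_power m)" and ?MA = "multi_associahedron (2 * m) (m - 2)"
  have sub: "I \<subseteq> {1..3 * m}" if "I \<in> ?SC" for I
    using that by (simp add: subword_complex_c213_iff)
  note inj = inj_on_diagonal_at[OF m]
  have "bij_betw ((`) (diagonal_at m)) ?SC ?MA"
    unfolding bij_betw_def
  proof
    show "inj_on ((`) (diagonal_at m)) ?SC"
    proof (rule inj_onI)
      fix I J assume IJ: "I \<in> ?SC" "J \<in> ?SC" "diagonal_at m ` I = diagonal_at m ` J"
      then show "I = J"
        using inj_on_image_eq_iff[OF inj sub[OF IJ(1)] sub[OF IJ(2)]] by simp
    qed
    show "(`) (diagonal_at m) ` ?SC = ?MA"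
    proof
      show "(`) (diagonal_at m) ` ?SC \<subseteq> ?MA"
        using subword_complex_c213_iff_multi_associahedron[OF m] sub by blast
      show "?MA \<subseteq> (`) (diagonal_at m) ` ?SC"
      proof
        fix S assume S: "S \<in> ?MA"
        then have "S \<subseteq> diagonal_at m ` {1..3 * m}"
          by (simp add: multi_associahedron_def relevant_diagonals_eq[OF m])
        then obtain I where "I \<subseteq> {1..3 * m}" "S = diagonal_at m ` I"
          unfolding subset_image_iff by blast
        then show "S \<in> (`) (diagonal_at m) ` ?SC"
          using subword_complex_c213_iff_multi_associahedron[OF m] S by blast
      qed
    qed
  qed
  moreover have "I \<subseteq> J \<longleftrightarrow> diagonal_at m ` I \<subseteq> diagonal_at m ` J" if "I \<in> ?SC" "J \<in> ?SC" for I J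
    using inj_on_image_subset_iff[OF inj sub[OF that(1)] sub[OF that(2)]] by simp
  ultimately show ?thesis
    unfolding poset_isomorphic_def by (intro exI[of _ "(`) (diagonal_at m)"]) simp
qed

section \<open>The fan of D213\<close>

theorem theorem8p3:
  fixes m :: nat and a b c :: "nat \<Rightarrow> real"
    and M :: "real^'r::{finite,linorder}^'d"
  assumes "m \<ge> 3"
    and "CARD('r) = 3 * m"
    and "CARD('d) = 3 * m - 6"
    and "c213_signature_inequalities m a b c"
    and "gale_dual (D213 m a b c) M"
  shows "complete_fan_realizing (subword_complex (c213_power m)) (column_at M) \<and>
    (let k = m - 2 in
      poset_isomorphic (fan_cones (subword_complex (c213_power m)) (column_at M))
        (multi_associahedron (2 * k + 4) k))"
proof -
  let ?SC = "subword_complex (c213_power m)"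
  have face: "I \<subseteq> {1..3 * m}" "w0_pattern ({1..m} - index_set pos1 m I) ({1..m} - index_set pos2 m I)
      ({1..m} - index_set pos3 m I)" if "I \<in> ?SC" for I
    using that by (simp_all add: subword_complex_c213_iff)
  interpret unique_representation_complex ?SC "{1..3 * m}" "column_at M"
  proof
    show "I \<subseteq> {1..3 * m}" if "I \<in> ?SC" for I using face(1) that .
    show "J \<in> ?SC" if "I \<in> ?SC" "J \<subseteq> I" for I J
      unfolding subword_complex_c213_iff
    proof
      show "J \<subseteq> {1..3 * m}" using that face(1) by blast
      show "w0_pattern ({1..m} - index_set pos1 m J) ({1..m} - index_set pos2 m J)
          ({1..m} - index_set pos3 m J)"
        by (rule w0_pattern_mono[OF face(2)[OF that(1)]]) (use that in \<open>auto simp: index_set_def\<close>)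
    qed
    have "w0_pattern {1..m} {1..m} {1..m}"
      unfolding w0_pattern_def
    proof (intro conjI)
      show "\<exists>i\<in>{1..m}. \<exists>j\<in>{1..m}. \<exists>k\<in>{1..m}. k \<le> j \<and> j < i"
        by (rule bexI[of _ 2], rule bexI[of _ 1], rule bexI[of _ 1]) (use \<open>m \<ge> 3\<close> in auto)
      show "\<exists>i\<in>{1..m}. \<exists>j\<in>{1..m}. \<exists>k\<in>{1..m}. i \<le> j \<and> j < k"
        by (rule bexI[of _ 1], rule bexI[of _ 1], rule bexI[of _ 2]) (use \<open>m \<ge> 3\<close> in auto)
      show "\<exists>j\<in>{1..m}. \<exists>i\<in>{1..m}. \<exists>k\<in>{1..m}. \<exists>l\<in>{1..m}. j < i \<and> j < k \<and> i \<le> l \<and> k \<le> l"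
        by (rule bexI[of _ 1], rule bexI[of _ 2], rule bexI[of _ 2], rule bexI[of _ 2])
          (use \<open>m \<ge> 3\<close> in auto)
    qed
    then have "{} \<in> ?SC"
      by (simp add: subword_complex_c213_iff index_set_def)
    then show "?SC \<noteq> {}" by blast
    show "\<exists>F\<in>?SC. I \<subseteq> F \<and> card F = DIM(real^'d)" if "I \<in> ?SC" for I
      using c213_complex_pure[OF that] assms(3) by simp
    show "\<exists>p. p \<notin> F \<and> insert p (F - {e}) \<in> ?SC" if "F \<in> ?SC" "card F = DIM(real^'d)" "e \<in> F" for F e
      using c213_complex_flip[OF that(1) _ _ that(3)] that(2) assms(1,3) by simp
  next
    fix f g :: "nat \<Rightarrow> real"
    assume f: "\<forall>i. 0 \<le> f i" "{i. f i \<noteq> 0} \<in> ?SC" and g: "\<forall>i. 0 \<le> g i" "{i. g i \<noteq> 0} \<in> ?SC"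
      and eq: "(\<Sum>i\<in>{1..3 * m}. f i *\<^sub>R column_at M i) = (\<Sum>i\<in>{1..3 * m}. g i *\<^sub>R column_at M i)"
    \<comment> \<open>The difference is >= 0 wherever \<open>g\<close> vanishes and <= 0 wherever
      \<open>f\<close> vanishes, and both zero sets contain the pattern because the supports are
      faces.\<close>
    have "f p - g p = 0" if "p \<in> {1..3 * m}" for p
    proof (rule two_signs_D213[OF assms(2,4,5) _ _ _ that])
      show "(\<Sum>p\<in>{1..3 * m}. (f p - g p) *\<^sub>R column_at M p) = 0"
        using eq by (simp add: scaleR_diff_left sum_subtractf)
      show "w0_pattern {i\<in>{1..m}. f (pos1 m i) - g (pos1 m i) \<ge> 0}
          {i\<in>{1..m}. f (pos2 m i) - g (pos2 m i) \<ge> 0} {i\<in>{1..m}. f (pos3 m i) - g (pos3 m i) \<ge> 0}"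
        using f(1) by (intro w0_pattern_mono[OF face(2)[OF g(2)]]) (auto simp: index_set_def)
      show "w0_pattern {i\<in>{1..m}. f (pos1 m i) - g (pos1 m i) \<le> 0}
          {i\<in>{1..m}. f (pos2 m i) - g (pos2 m i) \<le> 0} {i\<in>{1..m}. f (pos3 m i) - g (pos3 m i) \<le> 0}"
        using g(1) by (intro w0_pattern_mono[OF face(2)[OF f(2)]]) (auto simp: index_set_def)
    qed
    moreover have "f p = 0 \<and> g p = 0" if "p \<notin> {1..3 * m}" for p
      using face(1)[OF f(2)] face(1)[OF g(2)] that by blast
    ultimately show "f = g"
      by (intro ext) (metis eq_iff_diff_eq_0)
  qed simp
  have "2 * (m - 2) + 4 = 2 * m" using \<open>m \<ge> 3\<close> by simp
  moreover have "poset_isomorphic (fan_cones ?SC (column_at M)) (multi_associahedron (2 * m) (m - 2))"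
    using poset_isomorphic_fan_cones poset_isomorphic_multi_associahedron[OF \<open>m \<ge> 3\<close>]
    by (rule poset_isomorphic_trans)
  ultimately show ?thesis
    using complete_fan by (simp add: Let_def)
qed

end
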